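(* Let $M$ be a matroid of rank $k$ on a finite ground set $E$, and let $\mathrm{si}(M)$ be its simplification. Then: (a) $\widehat{\alpha}(I(M/\mathrm{cl}_M(F)))=\widehat{\alpha}(I(\mathrm{si}(M)/F))$ for every $0\le i\le k-1$ and every flat $F$ of $\mathrm{si}(M)$ of rank $i$. (b) $\widehat{\rho}(I(M))=\widehat{\rho}(I(\mathrm{si}(M)))$.
   Context: For a matroid $M$ on $E$, $\mathrm{cl}_M(A)$ denotes the closure of $A\subseteq E$ (the maximal subset of $E$ containing $A$ with the same rank as $A$), and a flat is a set $F$ with $\mathrm{cl}_M(F)=F$. $M/U$ denotes the usual matroid contraction of $U\subseteq E$, a matroid on $E\setminus U$. The simplification $\mathrm{si}(M)$ is the simple matroid obtained from $M$ by deleting all loops and, for each flat of rank $1$, retaining exactly one (non-loop) element and deleting all other elements; its ground set is a subset of $E$. Standing assumption: $\mathrm{rk}(M)<|E|$ for the given matroid $M$ (this is not required of $\mathrm{si}(M)$ or of contractions). Let $\mathbb{K}$ be a field. For a matroid $M$ on a finite ground set $E$, let $S=\mathbb{K}[x_e : e\in E]$ and define the facet ideal $I(M)=\langle \prod_{e\in B}x_e : B \text{ a basis of } M\rangle\subset S$. For a squarefree monomial ideal $I\subset S$, the $s$-th symbolic power is $I^{(s)}=\bigcap_{P\in \mathrm{Min}(I)}P^s$, where $\mathrm{Min}(I)$ is the set of minimal primes of $I$ (for $I=S$, $I^{(s)}=S$). Let $\alpha(I)$ be the least degree of a nonzero homogeneous element of $I$. The Waldschmidt constant is $\widehat{\alpha}(I)=\lim_{s\to\infty}\alpha(I^{(s)})/s$.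 The asymptotic resurgence is $\widehat{\rho}(I)=\sup\{s/r : s,r \text{ positive integers},\ I^{(st)}\not\subset I^{rt}\text{ for all } t\gg 0\}$ (the supremum of the empty set, occurring only for the unit ideal, is read as $0$). *)

theory Defs
  imports
    Complex_Main
    "HOL-Library.Extended_Real"
    "HOL-Library.Poly_Mapping"
    "HOL-Algebra.Ideal_Product"
begin

section \<open>Matroids\<close>

record 'a matroid =
  ground :: "'a set"
  indep :: "'a set \<Rightarrow> bool"

definition matroid :: "'a matroid \<Rightarrow> bool" where
  "matroid M \<longleftrightarrow>
     finite (ground M) \<and>
     (\<forall>X. indep M X \<longrightarrow> X \<subseteq> ground M) \<and>
     indep M {} \<and>
     (\<forall>X Y. indep M X \<longrightarrow> Y \<subseteq> X \<longrightarrow> indep M Y) \<and>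
     (\<forall>X Y. indep M X \<longrightarrow> indep M Y \<longrightarrow> card Y < card X \<longrightarrow>
        (\<exists>e\<in>X - Y. indep M (insert e Y)))"

definition basis :: "'a matroid \<Rightarrow> 'a set \<Rightarrow> bool" where
  "basis M B \<longleftrightarrow> indep M B \<and> (\<forall>C. indep M C \<longrightarrow> B \<subseteq> C \<longrightarrow> C = B)"

definition rank_of :: "'a matroid \<Rightarrow> 'a set \<Rightarrow> nat" where
  "rank_of M A = Max {card X |X. X \<subseteq> A \<and> indep M X}"

abbreviation rk :: "'a matroid \<Rightarrow> nat" where
  "rk M \<equiv> rank_of M (ground M)"

definition cl :: "'a matroid \<Rightarrow> 'a set \<Rightarrow> 'a set" where
  "cl M A = (GREATEST X. A \<subseteq> X \<and> X \<subseteq> ground M \<and> rank_of M X = rank_of M A)"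

definition flat :: "'a matroid \<Rightarrow> 'a set \<Rightarrow> bool" where
  "flat M F \<longleftrightarrow> F \<subseteq> ground M \<and> cl M F = F"

definition loop :: "'a matroid \<Rightarrow> 'a \<Rightarrow> bool" where
  "loop M e \<longleftrightarrow> e \<in> ground M \<and> \<not> indep M {e}"

definition restrict_to :: "'a matroid \<Rightarrow> 'a set \<Rightarrow> 'a matroid" where
  "restrict_to M T = \<lparr>ground = ground M \<inter> T, indep = (\<lambda>X. X \<subseteq> T \<and> indep M X)\<rparr>"

text \<open>A set is independent in the contraction by \<open>U\<close> iff adjoining a maximal independent
  subset of \<open>U\<close> to it gives an independent set; which one is chosen does not matter.\<close>

definition contract :: "'a matroid \<Rightarrow> 'a set \<Rightarrow> 'a matroid" where
  "contract M U = \<lparr>ground = ground M - U,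
     indep = (\<lambda>X. X \<subseteq> ground M - U \<and> (\<exists>B. basis (restrict_to M U) B \<and> indep M (X \<union> B)))\<rparr>"

text \<open>The simplification depends on the choice of one non-loop element in each flat of
  rank 1, so it is a relation: \<open>N\<close> is the simplification of \<open>M\<close> for some such choice.\<close>

definition is_simplification :: "'a matroid \<Rightarrow> 'a matroid \<Rightarrow> bool" where
  "is_simplification M N \<longleftrightarrow> (\<exists>T\<subseteq>ground M.
     (\<forall>e\<in>T. \<not> loop M e) \<and>
     (\<forall>G. flat M G \<and> rank_of M G = 1 \<longrightarrow> (\<exists>!e. e \<in> T \<inter> G)) \<and>
     N = restrict_to M T)"


section \<open>Polynomial rings\<close>

text \<open>Monomials are finitely supported exponent functions. The type contains the polynomials
  in all variables of type \<open>'a\<close>; \<open>mpoly_ring E\<close> is the polynomial ring in the variables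
  indexed by \<open>E\<close> only.\<close>

type_synonym ('a, 'k) mpoly = "('a \<Rightarrow>\<^sub>0 nat) \<Rightarrow>\<^sub>0 'k"

definition mpoly_ring :: "'a set \<Rightarrow> ('a, 'k::field) mpoly ring" where
  "mpoly_ring E = \<lparr>carrier = {f. \<forall>m\<in>Poly_Mapping.keys f. Poly_Mapping.keys m \<subseteq> E},
     monoid.mult = (*), one = 1, ring.zero = 0, add = (+)\<rparr>"

lemma mpoly_ring_cring: "cring (mpoly_ring E :: ('a, 'k::field) mpoly ring)"
proof -
  let ?R = "mpoly_ring E :: ('a, 'k) mpoly ring"
  have add: "f + g \<in> carrier ?R" if "f \<in> carrier ?R" "g \<in> carrier ?R" for f g
    using that Poly_Mapping.keys_add[of f g] by (auto simp: mpoly_ring_def)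
  have mult: "f * g \<in> carrier ?R" if fg: "f \<in> carrier ?R" "g \<in> carrier ?R" for f g
  proof -
    have "Poly_Mapping.keys m \<subseteq> E" if "m \<in> Poly_Mapping.keys (f * g)" for m
    proof -
      obtain a b where "m = a + b" "a \<in> Poly_Mapping.keys f" "b \<in> Poly_Mapping.keys g"
        using \<open>m \<in> Poly_Mapping.keys (f * g)\<close> Poly_Mapping.keys_mult[of f g] by blast
      then show ?thesis
        using fg Poly_Mapping.keys_add[of a b] unfolding mpoly_ring_def by simp blast
    qed
    then show ?thesis by (simp add: mpoly_ring_def)
  qed
  have neg: "- f \<in> carrier ?R" if "f \<in> carrier ?R" for f
    using that by (simp add: mpoly_ring_def)
  have zero: "\<zero>\<^bsub>?R\<^esub> \<in> carrier ?R" and one: "\<one>\<^bsub>?R\<^esub> \<in> carrier ?R"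
    by (simp_all add: mpoly_ring_def)
  have ops: "f \<oplus>\<^bsub>?R\<^esub> g = f + g" "f \<otimes>\<^bsub>?R\<^esub> g = f * g"
      "\<zero>\<^bsub>?R\<^esub> = 0" "\<one>\<^bsub>?R\<^esub> = 1" for f g
    by (simp_all add: mpoly_ring_def)
  show ?thesis
  proof (rule cringI)
    show "abelian_group ?R"
    proof (rule abelian_groupI)
      fix f assume "f \<in> carrier ?R"
      then show "\<exists>g\<in>carrier ?R. g \<oplus>\<^bsub>?R\<^esub> f = \<zero>\<^bsub>?R\<^esub>"
        using neg[of f] by (intro bexI[of _ "- f"]) (simp_all add: ops)
    qed (use add zero in \<open>simp_all add: ops ac_simps\<close>)
    show "Group.comm_monoid ?R"
      by (rule comm_monoidI) (use mult one in \<open>simp_all add: ops ac_simps\<close>)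
  qed (simp add: ops distrib_right)
qed

definition var :: "'a \<Rightarrow> ('a, 'k::field) mpoly" where
  "var e = Poly_Mapping.single (Poly_Mapping.single e 1) 1"

definition homogeneous :: "nat \<Rightarrow> ('a, 'k::field) mpoly \<Rightarrow> bool" where
  "homogeneous d f \<longleftrightarrow>
     (\<forall>m\<in>Poly_Mapping.keys f. (\<Sum>e\<in>Poly_Mapping.keys m. Poly_Mapping.lookup m e) = d)"

definition alpha :: "('a, 'k::field) mpoly set \<Rightarrow> nat" where
  "alpha I = (LEAST d. \<exists>f\<in>I. f \<noteq> 0 \<and> homogeneous d f)"


section \<open>Ideals and their asymptotic invariants\<close>

definition ideal_power :: "('r, 'm) ring_scheme \<Rightarrow> 'r set \<Rightarrow> nat \<Rightarrow> 'r set" where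
  "ideal_power R I n = I [^]\<^bsub>ideals_set R\<^esub> n"

definition min_primes :: "('r, 'm) ring_scheme \<Rightarrow> 'r set \<Rightarrow> 'r set set" where
  "min_primes R I = {P. primeideal P R \<and> I \<subseteq> P \<and>
     (\<forall>Q. primeideal Q R \<and> I \<subseteq> Q \<and> Q \<subseteq> P \<longrightarrow> Q = P)}"

text \<open>Intersecting with the carrier makes every symbolic power of the unit ideal, which has
  no minimal primes, the whole ring.\<close>

definition symbolic_power :: "('r, 'm) ring_scheme \<Rightarrow> 'r set \<Rightarrow> nat \<Rightarrow> 'r set" where
  "symbolic_power R I s = carrier R \<inter> (\<Inter>P\<in>min_primes R I. ideal_power R P s)"

text \<open>In the next two definitions \<open>I\<close> is an ideal of the polynomial ring with variables
  indexed by \<open>E\<close>.\<close>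

definition waldschmidt :: "'a set \<Rightarrow> ('a, 'k::field) mpoly set \<Rightarrow> real" where
  "waldschmidt E I = lim (\<lambda>s. real (alpha (symbolic_power (mpoly_ring E) I s)) / real s)"

text \<open>The supremum is taken in the extended reals, so that no boundedness condition is hidden
  in it; the case distinction is needed because the empty supremum there is \<open>-\<infinity>\<close>.\<close>

definition asymp_resurgence :: "'a set \<Rightarrow> ('a, 'k::field) mpoly set \<Rightarrow> ereal" where
  "asymp_resurgence E I =
     (let A = {ereal (real s / real r) |s r. 0 < s \<and> 0 < r \<and>
                 (\<forall>\<^sub>F t in sequentially.
                    \<not> symbolic_power (mpoly_ring E) I (s * t) \<subseteq> ideal_power (mpoly_ring E) I (r * t))}
      in if A = {} then 0 else Sup A)"

definition facet_ideal :: "'a matroid \<Rightarrow> ('a, 'k::field) mpoly set" where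
  "facet_ideal M = Idl\<^bsub>mpoly_ring (ground M)\<^esub> {\<Prod>e\<in>B. var e |B. basis M B}"

end

theory Submission
  imports Defs
begin

text \<open>The simplification remembers everything about the facet ideal except how exponents are
distributed inside a parallel class. Let \<open>\<pi>\<close> send every non-loop of the matroid to the
representative of its parallel class, and let \<open>push\<close> be the induced map on exponent vectors,
which adds up the exponents in each class and forgets those of the loops. A set is independent
in \<open>M\<close> iff it consists of non-loops, \<open>\<pi>\<close> is injective on it, and its image is independent in
the simplification (\<open>indep_retraction_iff\<close>); the same holds for the contractions by
\<open>cl M F\<close> and \<open>F\<close>. Hence the bases of the larger matroid are exactly the transversal lifts of the
bases of the smaller one, and what remains is a statement about clutters \<open>\<C>\<close> and their
blow-ups.

Every ideal involved is spanned by monomials, so it is described by a set of exponent vectors.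
The ordinary power \<open>I\<^sup>r\<close> corresponds to the \<open>r\<close>-fold sumset. The minimal primes of the ideal of
a clutter are generated by the variables of its minimal covers, and so a monomial lies in the
symbolic power \<open>I\<^sup>(\<^sup>s\<^sup>)\<close> iff its exponents have sum at least \<open>s\<close> on every cover
(\<open>symbolic_power_clutter\<close>). Under a blow-up, both sets of exponent vectors are the full preimages
under \<open>push\<close> of the corresponding sets below: for symbolic powers because a cover upstairs
contains the preimage of a cover downstairs (\<open>symbolic_exponents_blowup\<close>), for ordinary powers
because any decomposition of \<open>push m\<close> into a sum can be lifted to one of \<open>m\<close>
(\<open>push_eq_add_split\<close>). As \<open>push\<close> is surjective and does not increase the degree, with the
identity as a section, the symbolic powers upstairs and downstairs have the same initial degree
for every single \<open>s\<close>, and \<open>I\<^sup>(\<^sup>s\<^sup>) \<subseteq> I\<^sup>r\<close> holds upstairs iff it holds downstairs. So the sequences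
defining the two Waldschmidt constants, and the sets of ratios defining the two asymptotic
resurgences, coincide term by term.\<close>

section \<open>Spans of monomials and their powers\<close>

lemma exponent_induct [case_names zero add]:
  fixes m :: "'a \<Rightarrow>\<^sub>0 nat"
  assumes "P 0" and "\<And>m e. P m \<Longrightarrow> P (m + Poly_Mapping.single e 1)"
  shows "P m"
proof (induction "\<Sum>e\<in>Poly_Mapping.keys m. Poly_Mapping.lookup m e" arbitrary: m)
  case 0
  then have "m = 0" by (intro poly_mapping_eqI) (auto simp: in_keys_iff)
  with assms show ?case by simp
next
  case (Suc n)
  then obtain e where e: "e \<in> Poly_Mapping.keys m" by fastforce
  let ?m = "m - Poly_Mapping.single e 1"
  have lk: "Poly_Mapping.lookup ?m x = (if x = e then Poly_Mapping.lookup m e - 1 else Poly_Mapping.lookup m x)" for x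
    by (simp add: lookup_minus lookup_single)
  have "(\<Sum>e\<in>Poly_Mapping.keys ?m. Poly_Mapping.lookup ?m e) = (\<Sum>e\<in>Poly_Mapping.keys m. Poly_Mapping.lookup ?m e)"
    by (rule sum.mono_neutral_left) (auto simp: in_keys_iff lk[simplified] split: if_splits)
  also have "\<dots> = (\<Sum>x\<in>Poly_Mapping.keys m - {e}. Poly_Mapping.lookup m x) + (Poly_Mapping.lookup m e - 1)"
    using e by (subst sum.remove[of _ e]) (simp_all add: lk[simplified])
  also have "\<dots> = n"
    using e Suc(2) by (subst (asm) sum.remove[of _ e]) (auto simp: in_keys_iff)
  finally have "P ?m" using Suc(1) by simp
  moreover have "m = ?m + Poly_Mapping.single e 1"
    using e by (intro poly_mapping_eqI) (auto simp: lookup_add lk[simplified] lookup_single in_keys_iff when_def)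
  ultimately show ?case using assms(2) by metis
qed

text \<open>For a set \<open>U\<close> of exponent vectors that is closed under adding exponent vectors this is a monomial
ideal. Membership is tested monomial by monomial, which turns all questions about ideals below
into questions about sets of exponent vectors.\<close>

definition monomial_span :: "('a \<Rightarrow>\<^sub>0 nat) set \<Rightarrow> ('a, 'k::field) mpoly set" where
  "monomial_span U = {f. Poly_Mapping.keys f \<subseteq> U}"

definition exponents :: "'a set \<Rightarrow> ('a \<Rightarrow>\<^sub>0 nat) set" where
  "exponents E = {m. Poly_Mapping.keys m \<subseteq> E}"

text \<open>The exponent vectors of the \<open>n\<close>-th power of a monomial ideal. The zeroth power of an ideal is the
whole ring, hence the base case is the set of all exponent vectors on \<open>E\<close> and not \<open>{0}\<close>.\<close>

primrec iterated_sum :: "'a set \<Rightarrow> ('a \<Rightarrow>\<^sub>0 nat) set \<Rightarrow> nat \<Rightarrow> ('a \<Rightarrow>\<^sub>0 nat) set" where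
  "iterated_sum E U 0 = exponents E"
| "iterated_sum E U (Suc n) = {u + v |u v. u \<in> iterated_sum E U n \<and> v \<in> U}"

lemma exponents_add_iff:
  "m + n \<in> exponents E \<longleftrightarrow> m \<in> exponents E \<and> n \<in> exponents E"
  by (auto simp: exponents_def subset_iff in_keys_iff lookup_add)

lemma single_in_exponents: "Poly_Mapping.single e k \<in> exponents E \<longleftrightarrow> e \<in> E \<or> k = 0"
  by (simp add: exponents_def)

lemma exponents_zero: "0 \<in> exponents E"
  by (simp add: exponents_def)

lemma exponents_mono: "E \<subseteq> E' \<Longrightarrow> exponents E \<subseteq> exponents E'"
  by (auto simp: exponents_def)

lemma mpoly_ring_simps:
  "carrier (mpoly_ring E) = monomial_span (exponents E)"
  "f \<oplus>\<^bsub>mpoly_ring E\<^esub> g = f + g" "f \<otimes>\<^bsub>mpoly_ring E\<^esub> g = f * g"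
  "\<zero>\<^bsub>mpoly_ring E\<^esub> = 0" "\<one>\<^bsub>mpoly_ring E\<^esub> = 1"
  by (auto simp: mpoly_ring_def monomial_span_def exponents_def)

lemma monomial_mem_span:
  "Poly_Mapping.single m c \<in> (monomial_span U :: ('a, 'k::field) mpoly set) \<longleftrightarrow> m \<in> U \<or> c = 0"
  by (simp add: monomial_span_def)

lemma monomial_span_subset_iff:
  "(monomial_span U :: ('a, 'k::field) mpoly set) \<subseteq> monomial_span V \<longleftrightarrow> U \<subseteq> V"
proof
  assume *: "(monomial_span U :: ('a, 'k) mpoly set) \<subseteq> monomial_span V"
  show "U \<subseteq> V"
  proof
    fix m assume "m \<in> U"
    then have "Poly_Mapping.single m (1::'k) \<in> monomial_span U"
      by (simp add: monomial_mem_span)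
    with * have "Poly_Mapping.single m (1::'k) \<in> monomial_span V" ..
    then show "m \<in> V" by (simp add: monomial_mem_span)
  qed
qed (auto simp: monomial_span_def)

lemma keys_remove_term:
  fixes f :: "'b \<Rightarrow>\<^sub>0 'k::ab_group_add"
  shows "Poly_Mapping.keys (f - Poly_Mapping.single m (Poly_Mapping.lookup f m)) = Poly_Mapping.keys f - {m}"
  by (auto simp: in_keys_iff lookup_minus lookup_single when_def split: if_splits)

lemma monomial_span_induct [consumes 1, case_names zero add monomial]:
  assumes f: "f \<in> monomial_span U"
    and zero: "P 0"
    and add: "\<And>f g. P f \<Longrightarrow> P g \<Longrightarrow> P (f + g)"
    and monomial: "\<And>m c. m \<in> U \<Longrightarrow> P (Poly_Mapping.single m c)"
  shows "P f"
proof -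
  have "P f" if "finite K" "K = Poly_Mapping.keys f" "K \<subseteq> U" for K f
    using that
  proof (induction K arbitrary: f rule: finite_induct)
    case empty
    then have "f = 0" by (metis keys_eq_empty)
    then show ?case using zero by simp
  next
    case (insert m K)
    let ?g = "f - Poly_Mapping.single m (Poly_Mapping.lookup f m)"
    have "Poly_Mapping.keys ?g = Poly_Mapping.keys f - {m}"
      by (rule keys_remove_term)
    also have "\<dots> = K" using insert.hyps(2) unfolding insert.prems(1)[symmetric] by simp
    finally have "P ?g" using insert.prems(2) by (intro insert.IH) simp_all
    moreover have "P (Poly_Mapping.single m (Poly_Mapping.lookup f m))"
      using insert.prems(2) by (intro monomial) simp
    ultimately have "P (?g + Poly_Mapping.single m (Poly_Mapping.lookup f m))" by (rule add)
    then show ?case by simp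
  qed
  then show ?thesis using f by (simp add: monomial_span_def)
qed

lemma monomial_span_add: "f \<in> monomial_span U \<Longrightarrow> g \<in> monomial_span U \<Longrightarrow> f + g \<in> monomial_span U"
  using Poly_Mapping.keys_add[of f g] by (auto simp: monomial_span_def)

lemma monomial_span_mult:
  assumes "f \<in> monomial_span U" "g \<in> monomial_span V"
    and "\<And>u v. u \<in> U \<Longrightarrow> v \<in> V \<Longrightarrow> u + v \<in> W"
  shows "f * g \<in> monomial_span W"
proof -
  have "m \<in> W" if "m \<in> Poly_Mapping.keys (f * g)" for m
    using that keys_mult[of f g] assms unfolding monomial_span_def by blast
  then show ?thesis by (auto simp: monomial_span_def)
qed

text \<open>The inclusion from left to right holds because the exponents of a product are sums of exponents of
the factors. Conversely the product contains every monomial with exponent \<open>u + v\<close>, as the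
product of two monomials, and it is closed under addition.\<close>

lemma ideal_prod_monomial_span:
  "ideal_prod (mpoly_ring E) (monomial_span U) (monomial_span V :: ('a, 'k::field) mpoly set) =
    monomial_span {u + v |u v. u \<in> U \<and> v \<in> V}"
proof (intro equalityI subsetI)
  let ?W = "{u + v |u v. u \<in> U \<and> v \<in> V}"
  fix f :: "('a, 'k) mpoly"
  show "f \<in> monomial_span ?W" if "f \<in> ideal_prod (mpoly_ring E) (monomial_span U) (monomial_span V)"
    using that
  proof induction
    case (prod i j)
    then show ?case by (auto simp: mpoly_ring_simps intro: monomial_span_mult)
  next
    case (sum s1 s2)
    then show ?case by (simp add: mpoly_ring_simps monomial_span_add)
  qed
  assume "f \<in> monomial_span ?W"
  then show "f \<in> ideal_prod (mpoly_ring E) (monomial_span U) (monomial_span V)"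
  proof (induction f rule: monomial_span_induct)
    case zero
    then show ?case
      using ideal_prod.prod[of 0 "monomial_span U" 0 "monomial_span V" "mpoly_ring E"]
      by (simp add: mpoly_ring_simps monomial_span_def)
  next
    case (add f g)
    then show ?case using ideal_prod.sum[of f "mpoly_ring E"] by (simp add: mpoly_ring_simps)
  next
    case (monomial m c)
    then obtain u v where uv: "m = u + v" "u \<in> U" "v \<in> V" by blast
    then have "Poly_Mapping.single m c = Poly_Mapping.single u c * Poly_Mapping.single v 1"
      by (simp add: mult_single)
    then show ?case
      using ideal_prod.prod[of "Poly_Mapping.single u c" "monomial_span U"
          "Poly_Mapping.single v 1" "monomial_span V" "mpoly_ring E"] uv
      by (simp add: mpoly_ring_simps monomial_mem_span)
  qed
qed

lemma ideal_power_monomial_span: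
  "ideal_power (mpoly_ring E) (monomial_span U :: ('a, 'k::field) mpoly set) n = monomial_span (iterated_sum E U n)"
proof (induction n)
  case 0
  then show ?case
    by (simp add: ideal_power_def nat_pow_def ideals_set_def mpoly_ring_simps)
next
  case (Suc n)
  have "ideal_power (mpoly_ring E) (monomial_span U :: ('a, 'k) mpoly set) (Suc n) =
      ideal_prod (mpoly_ring E) (ideal_power (mpoly_ring E) (monomial_span U) n) (monomial_span U)"
    by (simp add: ideal_power_def nat_pow_def ideals_set_def)
  also have "\<dots> = monomial_span (iterated_sum E U (Suc n))"
    by (simp add: Suc ideal_prod_monomial_span)
  finally show ?case .
qed

lemma ideal_monomial_span:
  assumes "U \<subseteq> exponents E"
    and up: "\<And>u m. u \<in> U \<Longrightarrow> m \<in> exponents E \<Longrightarrow> u + m \<in> U"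
  shows "ideal (monomial_span U :: ('a, 'k::field) mpoly set) (mpoly_ring E)"
proof -
  let ?R = "mpoly_ring E :: ('a, 'k) mpoly ring"
  interpret cring ?R by (rule mpoly_ring_cring)
  have sub: "monomial_span U \<subseteq> carrier ?R"
    using assms(1) by (simp add: mpoly_ring_simps monomial_span_subset_iff)
  have inv: "\<ominus>\<^bsub>?R\<^esub> f = - f" if "f \<in> carrier ?R" for f
    using that
    by (intro minus_equality) (auto simp: mpoly_ring_simps monomial_span_def)
  show ?thesis
  proof (rule idealI)
    show "ring ?R" by (rule ring_axioms)
    show "subgroup (monomial_span U) (add_monoid ?R)"
    proof (rule add.subgroupI)
      show "monomial_span U \<noteq> ({} :: ('a, 'k) mpoly set)"
        by (auto simp: monomial_span_def intro: exI[of _ 0])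
      fix a assume a: "a \<in> (monomial_span U :: ('a, 'k) mpoly set)"
      then have "\<ominus>\<^bsub>?R\<^esub> a = - a" using sub by (intro inv) blast
      with a show "\<ominus>\<^bsub>?R\<^esub> a \<in> monomial_span U"
        by (simp add: monomial_span_def)
    qed (use sub in \<open>auto simp: mpoly_ring_simps intro: monomial_span_add\<close>)
  next
    fix a x :: "('a, 'k) mpoly"
    assume ax: "a \<in> monomial_span U" "x \<in> carrier ?R"
    then have "a * x \<in> monomial_span U"
      using up by (auto simp: mpoly_ring_simps intro: monomial_span_mult)
    then show "x \<otimes>\<^bsub>?R\<^esub> a \<in> monomial_span U" "a \<otimes>\<^bsub>?R\<^esub> x \<in> monomial_span U"
      by (simp_all add: mpoly_ring_simps mult.commute)
  qed
qed

text \<open>All terms of a homogeneous polynomial have its degree, so an element of least degree may be taken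
to be a single monomial.\<close>

lemma alpha_monomial_span:
  "alpha (monomial_span U :: ('a, 'k::field) mpoly set) =
    (LEAST d. \<exists>m\<in>U. (\<Sum>e\<in>Poly_Mapping.keys m. Poly_Mapping.lookup m e) = d)"
proof -
  have "(\<exists>f\<in>(monomial_span U :: ('a, 'k) mpoly set). f \<noteq> 0 \<and> homogeneous d f) \<longleftrightarrow>
      (\<exists>m\<in>U. (\<Sum>e\<in>Poly_Mapping.keys m. Poly_Mapping.lookup m e) = d)" for d
  proof
    assume "\<exists>f\<in>(monomial_span U :: ('a, 'k) mpoly set). f \<noteq> 0 \<and> homogeneous d f"
    then obtain f :: "('a, 'k) mpoly" where "f \<in> monomial_span U" "f \<noteq> 0" "homogeneous d f" by blast
    moreover from this obtain m where "m \<in> Poly_Mapping.keys f" by (metis keys_eq_empty ex_in_conv)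
    ultimately show "\<exists>m\<in>U. (\<Sum>e\<in>Poly_Mapping.keys m. Poly_Mapping.lookup m e) = d"
      by (auto simp: homogeneous_def monomial_span_def)
  next
    assume "\<exists>m\<in>U. (\<Sum>e\<in>Poly_Mapping.keys m. Poly_Mapping.lookup m e) = d"
    then obtain m where "m \<in> U" "(\<Sum>e\<in>Poly_Mapping.keys m. Poly_Mapping.lookup m e) = d" by blast
    then have "Poly_Mapping.single m (1::'k) \<in> monomial_span U"
      "Poly_Mapping.single m (1::'k) \<noteq> 0" "homogeneous d (Poly_Mapping.single m (1::'k))"
      by (auto simp: monomial_mem_span homogeneous_def simp flip: keys_eq_empty)
    then show "\<exists>f\<in>(monomial_span U :: ('a, 'k) mpoly set). f \<noteq> 0 \<and> homogeneous d f" by blast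
  qed
  then show ?thesis by (simp add: alpha_def)
qed

section \<open>Symbolic powers of squarefree monomial ideals\<close>

text \<open>This is what makes a polynomial ring an integral domain: among the sums \<open>a + b\<close> one arises from
only one pair. The coordinates in \<open>V\<close> are treated one at a time. Passing to the vectors of \<open>A\<close> and
of \<open>B\<close> with maximal \<open>v\<close>-coordinate does not lose any representation of a sum of two such vectors,
and the remaining vectors agree at \<open>v\<close>.\<close>

lemma unique_sum_pair:
  fixes A B :: "('a \<Rightarrow>\<^sub>0 nat) set"
  assumes "finite V" "finite A" "A \<noteq> {}" "finite B" "B \<noteq> {}"
    and "\<And>a a' x. a \<in> A \<Longrightarrow> a' \<in> A \<Longrightarrow> x \<notin> V \<Longrightarrow> Poly_Mapping.lookup a x = Poly_Mapping.lookup a' x"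
    and "\<And>b b' x. b \<in> B \<Longrightarrow> b' \<in> B \<Longrightarrow> x \<notin> V \<Longrightarrow> Poly_Mapping.lookup b x = Poly_Mapping.lookup b' x"
  shows "\<exists>m\<in>A. \<exists>n\<in>B. \<forall>a\<in>A. \<forall>b\<in>B. a + b = m + n \<longrightarrow> a = m \<and> b = n"
  using assms
proof (induction V arbitrary: A B rule: finite_induct)
  case empty
  then obtain m n where "m \<in> A" "n \<in> B" by blast
  moreover have "a = m" if "a \<in> A" for a
    using empty.prems(5)[OF that \<open>m \<in> A\<close>] by (intro poly_mapping_eqI) simp
  moreover have "b = n" if "b \<in> B" for b
    using empty.prems(6)[OF that \<open>n \<in> B\<close>] by (intro poly_mapping_eqI) simp
  ultimately show ?case by blast
next
  case (insert v V)
  define p where "p = Max ((\<lambda>a. Poly_Mapping.lookup a v) ` A)"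
  define q where "q = Max ((\<lambda>b. Poly_Mapping.lookup b v) ` B)"
  define A' where "A' = {a\<in>A. Poly_Mapping.lookup a v = p}"
  define B' where "B' = {b\<in>B. Poly_Mapping.lookup b v = q}"
  have le: "Poly_Mapping.lookup a v \<le> p" if "a \<in> A" for a
    using that insert.prems by (simp add: p_def)
  have le': "Poly_Mapping.lookup b v \<le> q" if "b \<in> B" for b
    using that insert.prems by (simp add: q_def)
  have "p \<in> (\<lambda>a. Poly_Mapping.lookup a v) ` A" "q \<in> (\<lambda>b. Poly_Mapping.lookup b v) ` B"
    unfolding p_def q_def using insert.prems by (auto intro!: Max_in)
  then have "A' \<noteq> {}" "B' \<noteq> {}" by (auto simp: A'_def B'_def)
  moreover have "finite A'" "finite B'" using insert.prems by (auto simp: A'_def B'_def)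
  moreover have "Poly_Mapping.lookup a x = Poly_Mapping.lookup a' x" if "a \<in> A'" "a' \<in> A'" "x \<notin> V" for a a' x
    using that insert.prems(5)[of a a' x] by (cases "x = v") (auto simp: A'_def)
  moreover have "Poly_Mapping.lookup b x = Poly_Mapping.lookup b' x" if "b \<in> B'" "b' \<in> B'" "x \<notin> V" for b b' x
    using that insert.prems(6)[of b b' x] by (cases "x = v") (auto simp: B'_def)
  ultimately obtain m n where mn: "m \<in> A'" "n \<in> B'"
    and uniq: "\<And>a b. a \<in> A' \<Longrightarrow> b \<in> B' \<Longrightarrow> a + b = m + n \<Longrightarrow> a = m \<and> b = n"
    using insert.IH[of A' B'] by blast
  have "a = m \<and> b = n" if "a \<in> A" "b \<in> B" "a + b = m + n" for a b
  proof (rule uniq)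
    have "Poly_Mapping.lookup a v + Poly_Mapping.lookup b v = p + q"
      using that(3) mn by (metis (mono_tags, lifting) A'_def B'_def lookup_add mem_Collect_eq)
    with le[OF that(1)] le'[OF that(2)] show "a \<in> A'" "b \<in> B'"
      using that by (auto simp: A'_def B'_def)
  qed (use that in auto)
  then show ?case using mn by (auto simp: A'_def B'_def)
qed

text \<open>These are the exponents of the monomials divisible by some variable from \<open>C\<close>.\<close>

definition meeting :: "'a set \<Rightarrow> 'a set \<Rightarrow> ('a \<Rightarrow>\<^sub>0 nat) set" where
  "meeting E C = {m\<in>exponents E. Poly_Mapping.keys m \<inter> C \<noteq> {}}"

text \<open>The ideal generated by the variables indexed by \<open>C\<close> (see \<open>var_ideal_minimal\<close>).\<close>

definition var_ideal :: "'a set \<Rightarrow> 'a set \<Rightarrow> ('a, 'k::field) mpoly set" where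
  "var_ideal E C = monomial_span (meeting E C)"

text \<open>Primality of \<open>var_ideal\<close>: the terms of \<open>f\<close> and of \<open>g\<close> free of the variables in \<open>C\<close> have, by
\<open>unique_sum_pair\<close>, a product in which some coefficient comes from a single pair of terms. A term
divisible by a variable of \<open>C\<close> cannot contribute to that coefficient.\<close>

lemma product_avoiding:
  fixes f g :: "('a, 'k::field) mpoly"
  assumes "m \<in> Poly_Mapping.keys f" "Poly_Mapping.keys m \<inter> C = {}"
    and "n \<in> Poly_Mapping.keys g" "Poly_Mapping.keys n \<inter> C = {}"
  shows "\<exists>l\<in>Poly_Mapping.keys (f * g). Poly_Mapping.keys l \<inter> C = {}"
proof -
  define A where "A = {m\<in>Poly_Mapping.keys f. Poly_Mapping.keys m \<inter> C = {}}"
  define B where "B = {m\<in>Poly_Mapping.keys g. Poly_Mapping.keys m \<inter> C = {}}"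
  define V where "V = (\<Union>m\<in>A \<union> B. Poly_Mapping.keys m)"
  have fin: "finite A" "finite B" by (auto simp: A_def B_def)
  have "\<exists>m\<in>A. \<exists>n\<in>B. \<forall>a\<in>A. \<forall>b\<in>B. a + b = m + n \<longrightarrow> a = m \<and> b = n"
  proof (rule unique_sum_pair)
    show "finite V" using fin by (simp add: V_def)
    show "A \<noteq> {}" "B \<noteq> {}" using assms by (auto simp: A_def B_def)
    show "Poly_Mapping.lookup a x = Poly_Mapping.lookup a' x" if "a \<in> A" "a' \<in> A" "x \<notin> V" for a a' x
      using that by (auto simp: V_def in_keys_iff)
    show "Poly_Mapping.lookup a x = Poly_Mapping.lookup a' x" if "a \<in> B" "a' \<in> B" "x \<notin> V" for a a' x
      using that by (auto simp: V_def in_keys_iff)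
  qed (use fin in auto)
  then obtain m n where mn: "m \<in> A" "n \<in> B"
    and uniq: "\<And>a b. a \<in> A \<Longrightarrow> b \<in> B \<Longrightarrow> a + b = m + n \<Longrightarrow> a = m \<and> b = n"
    by blast
  have avoid: "Poly_Mapping.keys (m + n) \<inter> C = {}"
    using mn Poly_Mapping.keys_add[of m n] by (auto simp: A_def B_def)
  have eq: "a = m \<and> b = n" if "a \<in> Poly_Mapping.keys f" "b \<in> Poly_Mapping.keys g" "m + n = a + b" for a b
  proof (rule uniq)
    have "Poly_Mapping.keys (a + b) = Poly_Mapping.keys a \<union> Poly_Mapping.keys b"
      by (auto simp: in_keys_iff lookup_add)
    with that avoid show "a \<in> A" "b \<in> B" by (auto simp: A_def B_def)
  qed (use that in simp)
  let ?c = "Poly_Mapping.lookup f m" and ?d = "Poly_Mapping.lookup g n"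
  \<comment> \<open>Splitting off one term of each factor isolates the only product that contributes at \<open>m + n\<close>.\<close>
  define f' where "f' = f - Poly_Mapping.single m ?c"
  define g' where "g' = g - Poly_Mapping.single n ?d"
  have keys': "Poly_Mapping.keys f' = Poly_Mapping.keys f - {m}" "Poly_Mapping.keys g' = Poly_Mapping.keys g - {n}"
    unfolding f'_def g'_def by (rule keys_remove_term)+
  have "m + n \<notin> Poly_Mapping.keys (f' * g)"
    using keys_mult[of f' g] eq keys' by blast
  moreover have "m + n \<notin> Poly_Mapping.keys (Poly_Mapping.single m ?c * g')"
  proof
    assume "m + n \<in> Poly_Mapping.keys (Poly_Mapping.single m ?c * g')"
    then obtain b where "b \<in> Poly_Mapping.keys g'" "m + n = m + b"
      using keys_mult[of "Poly_Mapping.single m ?c" g'] by (auto split: if_splits)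
    then show False using keys' by simp
  qed
  moreover have "f * g = Poly_Mapping.single (m + n) (?c * ?d) + Poly_Mapping.single m ?c * g' + f' * g"
    by (simp add: f'_def g'_def algebra_simps mult_single)
  ultimately have "Poly_Mapping.lookup (f * g) (m + n) = ?c * ?d"
    by (simp add: lookup_add in_keys_iff)
  also have "\<dots> \<noteq> 0" using mn by (auto simp: A_def B_def in_keys_iff)
  finally show ?thesis using avoid by (auto simp: in_keys_iff)
qed

lemma primeideal_var_ideal:
  "primeideal (var_ideal E C :: ('a, 'k::field) mpoly set) (mpoly_ring E)"
proof (rule primeidealI)
  let ?R = "mpoly_ring E :: ('a, 'k) mpoly ring"
  show "cring ?R" by (rule mpoly_ring_cring)
  show "ideal (var_ideal E C) ?R"
    unfolding var_ideal_def
    by (rule ideal_monomial_span) (auto simp: meeting_def exponents_add_iff in_keys_iff lookup_add disjoint_iff)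
  have "Poly_Mapping.single 0 1 \<in> carrier ?R - var_ideal E C"
    unfolding mpoly_ring_simps var_ideal_def by (simp add: monomial_mem_span meeting_def exponents_zero del: single_one)
  then show "carrier ?R \<noteq> var_ideal E C" by blast
  fix f g assume fg: "f \<in> carrier ?R" "g \<in> carrier ?R" "f \<otimes>\<^bsub>?R\<^esub> g \<in> var_ideal E C"
  show "f \<in> var_ideal E C \<or> g \<in> var_ideal E C"
  proof (rule ccontr)
    assume "\<not> ?thesis"
    then obtain m n where "m \<in> Poly_Mapping.keys f" "Poly_Mapping.keys m \<inter> C = {}"
      "n \<in> Poly_Mapping.keys g" "Poly_Mapping.keys n \<inter> C = {}"
      using fg(1,2) by (auto simp: var_ideal_def monomial_span_def meeting_def mpoly_ring_simps)
    from product_avoiding[OF this] show False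
      using fg(3) by (auto simp: var_ideal_def monomial_span_def meeting_def mpoly_ring_simps)
  qed
qed

definition weight :: "'a set \<Rightarrow> ('a \<Rightarrow>\<^sub>0 nat) \<Rightarrow> nat" where
  "weight C m = (\<Sum>e\<in>C. Poly_Mapping.lookup m e)"

definition cover :: "'a set \<Rightarrow> 'a set set \<Rightarrow> 'a set \<Rightarrow> bool" where
  "cover E \<B> D \<longleftrightarrow> D \<subseteq> E \<and> (\<forall>B\<in>\<B>. B \<inter> D \<noteq> {})"

text \<open>The exponents of the monomials divisible by the squarefree monomial of some member of \<open>\<B>\<close>, that
is, of the monomials in the ideal generated by these (see \<open>Idl_squarefree\<close>).\<close>

definition clutter_exponents :: "'a set \<Rightarrow> 'a set set \<Rightarrow> ('a \<Rightarrow>\<^sub>0 nat) set" where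
  "clutter_exponents E \<B> = {m\<in>exponents E. \<exists>B\<in>\<B>. B \<subseteq> Poly_Mapping.keys m}"

definition symbolic_exponents :: "'a set \<Rightarrow> 'a set set \<Rightarrow> nat \<Rightarrow> ('a \<Rightarrow>\<^sub>0 nat) set" where
  "symbolic_exponents E \<B> s = {m\<in>exponents E. \<forall>D. cover E \<B> D \<longrightarrow> s \<le> weight D m}"

lemma weight_add: "weight C (m + n) = weight C m + weight C n"
  by (simp add: weight_def lookup_add sum.distrib)

lemma weight_mono: "finite D \<Longrightarrow> C \<subseteq> D \<Longrightarrow> weight C m \<le> weight D m"
  by (simp add: weight_def sum_mono2)

lemma weight_single: "finite C \<Longrightarrow> weight C (Poly_Mapping.single e k) = (k when e \<in> C)"
  by (simp add: weight_def lookup_single when_def sum.delta)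

lemma degree_eq_weight:
  assumes "finite E" "m \<in> exponents E"
  shows "(\<Sum>e\<in>Poly_Mapping.keys m. Poly_Mapping.lookup m e) = weight E m"
  unfolding weight_def using assms by (intro sum.mono_neutral_left) (auto simp: exponents_def in_keys_iff)

lemma split_off_single:
  fixes m :: "'a \<Rightarrow>\<^sub>0 nat"
  assumes "e \<in> Poly_Mapping.keys m"
  obtains m' where "m = m' + Poly_Mapping.single e 1"
proof (rule that[of "m - Poly_Mapping.single e 1"])
  show "m = m - Poly_Mapping.single e 1 + Poly_Mapping.single e 1"
    using assms by (intro poly_mapping_eqI) (auto simp: lookup_add lookup_minus lookup_single in_keys_iff when_def)
qed

text \<open>For the step from right to left, a vector of positive weight on \<open>C\<close> splits off a unit vector
at an element of \<open>C\<close>.\<close>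

lemma iterated_sum_meeting:
  assumes "finite C"
  shows "iterated_sum E (meeting E C) s = {m\<in>exponents E. s \<le> weight C m}"
proof (induction s)
  case 0
  then show ?case by simp
next
  case (Suc s)
  have "(\<exists>u v. m = u + v \<and> u \<in> exponents E \<and> s \<le> weight C u \<and> v \<in> meeting E C) \<longleftrightarrow>
      m \<in> exponents E \<and> Suc s \<le> weight C m" for m
  proof
    assume "\<exists>u v. m = u + v \<and> u \<in> exponents E \<and> s \<le> weight C u \<and> v \<in> meeting E C"
    then obtain u v where uv: "m = u + v" "u \<in> exponents E" "s \<le> weight C u" "v \<in> meeting E C" by blast
    then obtain e where e: "e \<in> Poly_Mapping.keys v" "e \<in> C" by (auto simp: meeting_def)
    then have "1 \<le> Poly_Mapping.lookup v e" by (simp add: in_keys_iff)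
    also have "\<dots> \<le> weight C v" unfolding weight_def using e assms by (intro member_le_sum) auto
    finally show "m \<in> exponents E \<and> Suc s \<le> weight C m"
      using uv by (simp add: exponents_add_iff weight_add meeting_def)
  next
    assume m: "m \<in> exponents E \<and> Suc s \<le> weight C m"
    then have "weight C m \<noteq> 0" by simp
    then obtain e where e: "e \<in> C" "e \<in> Poly_Mapping.keys m"
      unfolding weight_def using assms by (auto simp: in_keys_iff)
    from e(2) obtain m' where m': "m = m' + Poly_Mapping.single e 1" by (rule split_off_single)
    have "s \<le> weight C m'" using m e assms by (simp add: m' weight_add weight_single)
    moreover have "m' \<in> exponents E" "Poly_Mapping.single e 1 \<in> meeting E C"
      using m e unfolding m' by (simp_all add: exponents_add_iff meeting_def)
    ultimately show "\<exists>u v. m = u + v \<and> u \<in> exponents E \<and> s \<le> weight C u \<and> v \<in> meeting E C"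
      using m' by blast
  qed
  then show ?case by (auto simp: Suc)
qed

lemma prod_var: "finite B \<Longrightarrow>
  (\<Prod>e\<in>B. var e :: ('a, 'k::field) mpoly) = Poly_Mapping.single (\<Sum>e\<in>B. Poly_Mapping.single e 1) 1"
  by (induction B rule: finite_induct) (simp_all add: var_def mult_single)

lemma lookup_sum_single: "finite B \<Longrightarrow>
  Poly_Mapping.lookup (\<Sum>e\<in>B. Poly_Mapping.single e (1::nat)) x = (1 when x \<in> B)"
  by (simp add: lookup_sum lookup_single when_def sum.delta')

lemma keys_sum_single: "finite B \<Longrightarrow>
  Poly_Mapping.keys (\<Sum>e\<in>B. Poly_Mapping.single e (1::nat)) = B"
  by (auto simp: in_keys_iff lookup_sum_single when_def simp del: One_nat_def split: if_splits)

lemma clutter_exponents_up: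
  "u \<in> clutter_exponents E \<B> \<Longrightarrow> m \<in> exponents E \<Longrightarrow> u + m \<in> clutter_exponents E \<B>"
  by (auto simp: clutter_exponents_def exponents_add_iff in_keys_iff lookup_add subset_iff)

lemma ideal_clutter: "ideal (monomial_span (clutter_exponents E \<B>) :: ('a, 'k::field) mpoly set) (mpoly_ring E)"
  by (rule ideal_monomial_span) (auto simp: clutter_exponents_up, auto simp: clutter_exponents_def)

lemma prod_var_mem_iff:
  assumes "finite E" "B \<subseteq> E"
  shows "(\<Prod>e\<in>B. var e) \<in> (monomial_span (clutter_exponents E \<B>) :: ('a, 'k::field) mpoly set) \<longleftrightarrow> (\<exists>C\<in>\<B>. C \<subseteq> B)"
  using assms finite_subset[of B E]
  by (simp add: prod_var monomial_mem_span clutter_exponents_def exponents_def keys_sum_single del: One_nat_def)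

lemma Idl_squarefree:
  fixes E :: "'a set"
  assumes E: "finite E" and sub: "\<B> \<subseteq> Pow E"
  shows "Idl\<^bsub>mpoly_ring E\<^esub> {\<Prod>e\<in>B. var e |B. B \<in> \<B>} =
    (monomial_span (clutter_exponents E \<B>) :: ('a, 'k::field) mpoly set)"
proof
  let ?R = "mpoly_ring E :: ('a, 'k) mpoly ring"
  let ?G = "{\<Prod>e\<in>B. var e |B. B \<in> \<B>} :: ('a, 'k) mpoly set"
  interpret cring ?R by (rule mpoly_ring_cring)
  have G: "?G \<subseteq> monomial_span (clutter_exponents E \<B>)"
    using prod_var_mem_iff[OF E, where ?'k = 'k] sub by blast
  then show "Idl\<^bsub>?R\<^esub> ?G \<subseteq> monomial_span (clutter_exponents E \<B>)"
    by (rule genideal_minimal[OF ideal_clutter])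
  have "?G \<subseteq> carrier ?R"
    using G additive_subgroup.a_subset[OF ideal.axioms(1)[OF ideal_clutter[of E \<B>]]] by blast
  then interpret I: ideal "Idl\<^bsub>?R\<^esub> ?G" ?R by (rule genideal_ideal)
  have GI: "?G \<subseteq> Idl\<^bsub>?R\<^esub> ?G" by (rule genideal_self) fact
  show "monomial_span (clutter_exponents E \<B>) \<subseteq> Idl\<^bsub>?R\<^esub> ?G"
  proof
    fix f :: "('a, 'k) mpoly" assume "f \<in> monomial_span (clutter_exponents E \<B>)"
    then show "f \<in> Idl\<^bsub>?R\<^esub> ?G"
    proof (induction f rule: monomial_span_induct)
      case zero
      then show ?case using additive_subgroup.zero_closed[OF I.is_additive_subgroup] by (simp add: mpoly_ring_simps)
    next
      case (add f g)
      then show ?case using additive_subgroup.a_closed[OF I.is_additive_subgroup, of f g] by (simp add: mpoly_ring_simps)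
    next
      case (monomial m c)
      then obtain B where B: "B \<in> \<B>" "B \<subseteq> Poly_Mapping.keys m" and m: "m \<in> exponents E"
        by (auto simp: clutter_exponents_def)
      have fB: "finite B" using B(1) sub E by (auto intro: finite_subset)
      let ?b = "\<Sum>e\<in>B. Poly_Mapping.single e (1::nat)"
      have split: "m = ?b + (m - ?b)"
        using B(2) fB by (intro poly_mapping_eqI) (auto simp: lookup_add lookup_minus lookup_sum_single when_def in_keys_iff subset_iff Suc_le_eq simp del: One_nat_def)
      then have "m - ?b \<in> exponents E" using m by (metis exponents_add_iff)
      then have "Poly_Mapping.single (m - ?b) c \<in> carrier ?R"
        by (simp add: mpoly_ring_simps monomial_mem_span)
      moreover have "(\<Prod>e\<in>B. var e) \<in> Idl\<^bsub>?R\<^esub> ?G" using GI B(1) by blast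
      ultimately have "(\<Prod>e\<in>B. var e) * Poly_Mapping.single (m - ?b) c \<in> Idl\<^bsub>?R\<^esub> ?G"
        using I.I_r_closed[of "\<Prod>e\<in>B. var e"] by (simp add: mpoly_ring_simps)
      moreover have "(\<Prod>e\<in>B. var e) * Poly_Mapping.single (m - ?b) c = Poly_Mapping.single m c"
        using fB split by (simp add: prod_var mult_single del: One_nat_def)
      ultimately show ?case by simp
    qed
  qed
qed

text \<open>The empty product is no exception: it is \<open>1\<close>, which lies in no prime ideal.\<close>

lemma prime_contains_var:
  assumes "primeideal P (mpoly_ring E :: ('a, 'k::field) mpoly ring)"
    and "finite B" "B \<subseteq> E" "(\<Prod>e\<in>B. var e) \<in> P"
  shows "\<exists>e\<in>B. var e \<in> P"
  using assms(2-)
proof (induction B rule: finite_induct)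
  case empty
  interpret primeideal P "mpoly_ring E :: ('a, 'k) mpoly ring" by fact
  from empty have "\<one>\<^bsub>mpoly_ring E\<^esub> \<in> P" by (simp add: mpoly_ring_simps)
  then show ?case using one_imp_carrier I_notcarr by blast
next
  case (insert e B)
  interpret primeideal P "mpoly_ring E :: ('a, 'k) mpoly ring" by fact
  have "var e \<in> carrier (mpoly_ring E :: ('a, 'k) mpoly ring)"
    using insert.prems by (simp add: mpoly_ring_simps var_def monomial_mem_span single_in_exponents)
  moreover have "(\<Prod>e\<in>B. var e) \<in> carrier (mpoly_ring E :: ('a, 'k) mpoly ring)"
    using insert by (simp add: mpoly_ring_simps prod_var monomial_mem_span exponents_def keys_sum_single del: One_nat_def)
  ultimately show ?case using I_prime[of "var e" "\<Prod>e\<in>B. var e"] insert by (auto simp: mpoly_ring_simps)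
qed

lemma var_mem_var_ideal: "e \<in> E \<Longrightarrow> (var e :: ('a, 'k::field) mpoly) \<in> var_ideal E C \<longleftrightarrow> e \<in> C"
  by (simp add: var_def var_ideal_def monomial_mem_span meeting_def single_in_exponents)

lemma var_ideal_minimal:
  assumes I: "ideal P (mpoly_ring E :: ('a, 'k::field) mpoly ring)" and vars: "\<And>e. e \<in> C \<Longrightarrow> var e \<in> P"
  shows "(var_ideal E C :: ('a, 'k) mpoly set) \<subseteq> P"
proof
  interpret I: ideal P "mpoly_ring E :: ('a, 'k) mpoly ring" by (rule I)
  fix f :: "('a, 'k) mpoly" assume "f \<in> var_ideal E C"
  then show "f \<in> P" unfolding var_ideal_def
  proof (induction f rule: monomial_span_induct)
    case zero
    then show ?case using additive_subgroup.zero_closed[OF I.is_additive_subgroup] by (simp add: mpoly_ring_simps)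
  next
    case (add f g)
    then show ?case using additive_subgroup.a_closed[OF I.is_additive_subgroup, of f g] by (simp add: mpoly_ring_simps)
  next
    case (monomial m c)
    then obtain e where e: "e \<in> C" "e \<in> Poly_Mapping.keys m" and m: "m \<in> exponents E"
      by (auto simp: meeting_def)
    obtain m' where m': "m = m' + Poly_Mapping.single e 1" using e(2) by (rule split_off_single)
    have "Poly_Mapping.single m' c \<in> carrier (mpoly_ring E :: ('a, 'k) mpoly ring)"
      using m by (simp add: m' mpoly_ring_simps monomial_mem_span exponents_add_iff)
    then have "Poly_Mapping.single m' c * var e \<in> P"
      using I.I_l_closed[OF vars[OF e(1)]] by (simp add: mpoly_ring_simps)
    then show ?case by (simp add: m' var_def mult_single)
  qed
qed

lemma clutter_ideal_subset_var_ideal: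
  assumes "cover E \<B> D"
  shows "(monomial_span (clutter_exponents E \<B>) :: ('a, 'k::field) mpoly set) \<subseteq> var_ideal E D"
  using assms unfolding var_ideal_def monomial_span_subset_iff
  by (fastforce simp: clutter_exponents_def meeting_def cover_def)

lemma cover_of_prime:
  assumes E: "finite E" and sub: "\<B> \<subseteq> Pow E"
    and P: "primeideal P (mpoly_ring E :: ('a, 'k::field) mpoly ring)"
    and IP: "monomial_span (clutter_exponents E \<B>) \<subseteq> P"
  shows "cover E \<B> {e\<in>E. var e \<in> P}"
  unfolding cover_def
proof (intro conjI ballI)
  fix B assume B: "B \<in> \<B>"
  with sub have BE: "B \<subseteq> E" by blast
  then have "(\<Prod>e\<in>B. var e) \<in> P" using IP prod_var_mem_iff[OF E BE, of \<B>] B by blast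
  then have "\<exists>e\<in>B. var e \<in> P"
    using prime_contains_var[OF P] BE E by (meson finite_subset)
  with BE show "B \<inter> {e\<in>E. var e \<in> P} \<noteq> {}" by auto
qed auto

text \<open>The variables in a prime ideal \<open>P\<close> that contains the squarefree ideal form a cover \<open>D\<close>, because \<open>P\<close>
contains a factor of each generator. Hence \<open>P\<close> contains \<open>var_ideal E D\<close>, which is itself
a prime ideal over the squarefree ideal.\<close>

lemma min_primes_clutter:
  assumes E: "finite E" and sub: "\<B> \<subseteq> Pow E"
  shows "min_primes (mpoly_ring E) (monomial_span (clutter_exponents E \<B>) :: ('a, 'k::field) mpoly set) =
    {var_ideal E D |D. cover E \<B> D \<and> (\<forall>D'\<subseteq>D. cover E \<B> D' \<longrightarrow> D' = D)}"
proof (intro equalityI subsetI)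
  let ?R = "mpoly_ring E :: ('a, 'k) mpoly ring"
  let ?I = "monomial_span (clutter_exponents E \<B>) :: ('a, 'k) mpoly set"
  fix P assume "P \<in> min_primes ?R ?I"
  then have P: "primeideal P ?R" "?I \<subseteq> P"
    and min: "\<And>Q. primeideal Q ?R \<Longrightarrow> ?I \<subseteq> Q \<Longrightarrow> Q \<subseteq> P \<Longrightarrow> Q = P"
    unfolding min_primes_def by blast+
  let ?D = "{e\<in>E. var e \<in> P}"
  have cov: "cover E \<B> ?D" using E sub P by (rule cover_of_prime)
  have le: "var_ideal E D' \<subseteq> P" if "D' \<subseteq> ?D" for D'
    using that by (intro var_ideal_minimal[OF primeideal.axioms(1)[OF P(1)]]) auto
  have eq: "var_ideal E D' = P" if "D' \<subseteq> ?D" "cover E \<B> D'" for D'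
    using that by (intro min primeideal_var_ideal clutter_ideal_subset_var_ideal le)
  have "D' = ?D" if "D' \<subseteq> ?D" "cover E \<B> D'" for D'
  proof -
    have "e \<in> D'" if "e \<in> ?D" for e
      using that eq[OF \<open>D' \<subseteq> ?D\<close> \<open>cover E \<B> D'\<close>] var_mem_var_ideal[of e E D', where ?'k = 'k] by auto
    with that show ?thesis by blast
  qed
  with cov eq[of ?D] show "P \<in> {var_ideal E D |D. cover E \<B> D \<and> (\<forall>D'\<subseteq>D. cover E \<B> D' \<longrightarrow> D' = D)}"
    by blast
next
  let ?R = "mpoly_ring E :: ('a, 'k) mpoly ring"
  let ?I = "monomial_span (clutter_exponents E \<B>) :: ('a, 'k) mpoly set"
  fix P :: "('a, 'k) mpoly set"
  assume "P \<in> {var_ideal E D |D. cover E \<B> D \<and> (\<forall>D'\<subseteq>D. cover E \<B> D' \<longrightarrow> D' = D)}"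
  then obtain D where D: "P = var_ideal E D" "cover E \<B> D" and
    min: "\<And>D'. D' \<subseteq> D \<Longrightarrow> cover E \<B> D' \<Longrightarrow> D' = D" by blast
  have "Q = P" if Q: "primeideal Q ?R" "?I \<subseteq> Q" "Q \<subseteq> P" for Q
  proof -
    have "{e\<in>E. var e \<in> Q} \<subseteq> D"
      using Q(3) D(1) var_mem_var_ideal[of _ E D, where ?'k = 'k] by auto
    then have "{e\<in>E. var e \<in> Q} = D" using cover_of_prime[OF E sub Q(1,2)] by (rule min)
    then have "P \<subseteq> Q"
      unfolding D(1) by (intro var_ideal_minimal[OF primeideal.axioms(1)[OF Q(1)]]) auto
    with Q(3) show ?thesis by simp
  qed
  then show "P \<in> min_primes ?R ?I"
    using D primeideal_var_ideal clutter_ideal_subset_var_ideal[OF D(2), where ?'k = 'k]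
    unfolding min_primes_def by blast
qed

lemma minimal_cover_exists:
  assumes "finite E" "cover E \<B> D"
  obtains D' where "D' \<subseteq> D" "cover E \<B> D'" "\<forall>D''\<subseteq>D'. cover E \<B> D'' \<longrightarrow> D'' = D'"
proof -
  have "finite {D'. D' \<subseteq> D \<and> cover E \<B> D'}"
    by (rule finite_subset[of _ "Pow E"]) (use assms in \<open>auto simp: cover_def\<close>)
  from finite_has_minimal[OF this] assms(2) obtain D' where "D' \<in> {D'. D' \<subseteq> D \<and> cover E \<B> D'}"
    "\<forall>D''\<in>{D'. D' \<subseteq> D \<and> cover E \<B> D'}. D'' \<subseteq> D' \<longrightarrow> D' = D''" by blast
  then show thesis by (intro that[of D']) auto
qed

text \<open>Weights grow with the set on which they are taken, so the condition on minimal covers extends to all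
covers. The form with all covers is the one that behaves well under blow-ups, since the preimage
of a minimal cover then need not be shown to be minimal.\<close>

lemma symbolic_power_clutter:
  assumes E: "finite E" and sub: "\<B> \<subseteq> Pow E"
  shows "symbolic_power (mpoly_ring E) (monomial_span (clutter_exponents E \<B>) :: ('a, 'k::field) mpoly set) s =
    monomial_span (symbolic_exponents E \<B> s)"
proof -
  let ?min = "{D. cover E \<B> D \<and> (\<forall>D'\<subseteq>D. cover E \<B> D' \<longrightarrow> D' = D)}"
  have pow: "ideal_power (mpoly_ring E) (var_ideal E D :: ('a, 'k) mpoly set) s =
      monomial_span {m\<in>exponents E. s \<le> weight D m}" if "D \<in> ?min" for D
    using that E unfolding var_ideal_def ideal_power_monomial_span
    by (subst iterated_sum_meeting) (auto simp: cover_def intro: finite_subset)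
  have "symbolic_power (mpoly_ring E) (monomial_span (clutter_exponents E \<B>) :: ('a, 'k) mpoly set) s =
      monomial_span (exponents E) \<inter> (\<Inter>D\<in>?min. monomial_span {m\<in>exponents E. s \<le> weight D m})"
    unfolding symbolic_power_def min_primes_clutter[OF E sub] mpoly_ring_simps
      setcompr_eq_image image_image by (intro arg_cong2[of _ _ _ _ "(\<inter>)"] INF_cong refl pow)
  also have "\<dots> = monomial_span {m\<in>exponents E. \<forall>D\<in>?min. s \<le> weight D m}"
    by (auto simp: monomial_span_def)
  also have "{m\<in>exponents E. \<forall>D\<in>?min. s \<le> weight D m} = symbolic_exponents E \<B> s"
  proof -
    have "s \<le> weight D m" if *: "\<forall>D\<in>?min. s \<le> weight D m" and D: "cover E \<B> D" for D m
    proof -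
      obtain D' where D': "D' \<subseteq> D" and "cover E \<B> D'" "\<forall>D''\<subseteq>D'. cover E \<B> D'' \<longrightarrow> D'' = D'"
        by (rule minimal_cover_exists[OF E D])
      then have min: "D' \<in> ?min" by simp
      have "s \<le> weight D' m" using * min by (rule bspec)
      also have "\<dots> \<le> weight D m"
        using D' D E by (intro weight_mono) (auto simp: cover_def intro: finite_subset)
      finally show ?thesis .
    qed
    then show ?thesis unfolding symbolic_exponents_def by blast
  qed
  finally show ?thesis .
qed

section \<open>Blowing up a clutter along a retraction\<close>

text \<open>The statement also covers the case that both predicates are empty, where \<open>Least\<close> has
no meaningful value.\<close>

lemma Least_eqI:
  fixes P Q :: "nat \<Rightarrow> bool"
  assumes "\<And>d. Q d \<Longrightarrow> P d" "\<And>d. P d \<Longrightarrow> \<exists>d'\<le>d. Q d'"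
  shows "Least P = Least Q"
proof (cases "\<exists>d. Q d")
  case True
  then have Q: "Q (Least Q)" by (auto intro: LeastI)
  show ?thesis
  proof (rule Least_equality)
    show "P (Least Q)" using assms(1) Q .
    show "Least Q \<le> d" if "P d" for d
      using assms(2)[OF that] Least_le[of Q] by (meson order_trans)
  qed
next
  case False
  with assms have "P = Q" by blast
  then show ?thesis by simp
qed

text \<open>The combinatorial shape of a simplification: \<open>T\<close> is the set of representatives, \<open>E\<^sub>0\<close> the set of
non-loops, and \<open>\<pi>\<close> sends a non-loop to its representative.\<close>

locale retraction =
  fixes E E\<^sub>0 T :: "'a set" and \<pi> :: "'a \<Rightarrow> 'a"
  assumes finite_E: "finite E" and E\<^sub>0_subset: "E\<^sub>0 \<subseteq> E" and T_subset: "T \<subseteq> E\<^sub>0"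
    and pi_mem: "\<And>e. e \<in> E\<^sub>0 \<Longrightarrow> \<pi> e \<in> T" and pi_id: "\<And>t. t \<in> T \<Longrightarrow> \<pi> t = t"
begin

definition push :: "('a \<Rightarrow>\<^sub>0 nat) \<Rightarrow> ('a \<Rightarrow>\<^sub>0 nat)" where
  "push m = (\<Sum>e\<in>E\<^sub>0. Poly_Mapping.single (\<pi> e) (Poly_Mapping.lookup m e))"

definition blowup :: "'a set set \<Rightarrow> 'a set set" where
  "blowup \<C> = {B. B \<subseteq> E\<^sub>0 \<and> inj_on \<pi> B \<and> \<pi> ` B \<in> \<C>}"

lemma finite_sets: "finite E\<^sub>0" "finite T"
  using finite_E E\<^sub>0_subset T_subset by (meson finite_subset)+

lemma lookup_push: "Poly_Mapping.lookup (push m) t = (\<Sum>e\<in>E\<^sub>0. Poly_Mapping.lookup m e when \<pi> e = t)"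
  by (simp add: push_def lookup_sum lookup_single)

lemma push_zero: "push 0 = 0"
  by (simp add: push_def)

lemma push_add: "push (m + n) = push m + push n"
  by (intro poly_mapping_eqI) (simp add: lookup_push lookup_add when_add_distrib sum.distrib)

lemma push_single: "push (Poly_Mapping.single e k) = (if e \<in> E\<^sub>0 then Poly_Mapping.single (\<pi> e) k else 0)"
proof -
  have "push (Poly_Mapping.single e k) = (\<Sum>x\<in>E\<^sub>0. if e = x then Poly_Mapping.single (\<pi> x) k else 0)"
    unfolding push_def by (intro sum.cong) (auto simp: lookup_single when_def)
  then show ?thesis using finite_sets by simp
qed

lemma keys_push: "Poly_Mapping.keys (push m) = \<pi> ` (Poly_Mapping.keys m \<inter> E\<^sub>0)"
  using finite_sets by (force simp: in_keys_iff lookup_push when_def split: if_splits)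

lemma push_mem: "push m \<in> exponents T"
  using pi_mem by (auto simp: exponents_def keys_push)

lemma push_id:
  assumes "m \<in> exponents T"
  shows "push m = m"
proof (rule poly_mapping_eqI)
  fix t
  have "Poly_Mapping.lookup (push m) t = (\<Sum>e\<in>E\<^sub>0. if e = t then Poly_Mapping.lookup m e else 0)"
    unfolding lookup_push
  proof (rule sum.cong)
    fix e assume "e \<in> E\<^sub>0"
    have "Poly_Mapping.lookup m e = 0 \<or> \<pi> e = e"
      using assms pi_id by (auto simp: exponents_def in_keys_iff)
    then show "(Poly_Mapping.lookup m e when \<pi> e = t) = (if e = t then Poly_Mapping.lookup m e else 0)"
      by (auto simp: when_def)
  qed simp
  also have "\<dots> = Poly_Mapping.lookup m t"
    using assms finite_sets T_subset by (auto simp: exponents_def in_keys_iff)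
  finally show "Poly_Mapping.lookup (push m) t = Poly_Mapping.lookup m t" .
qed

lemma exponents_T_subset: "exponents T \<subseteq> exponents E"
  using T_subset E\<^sub>0_subset by (intro exponents_mono) blast

lemma weight_push:
  assumes "finite C"
  shows "weight C (push m) = weight {e\<in>E\<^sub>0. \<pi> e \<in> C} m"
proof -
  have "weight C (push m) = (\<Sum>e\<in>E\<^sub>0. \<Sum>t\<in>C. Poly_Mapping.lookup m e when \<pi> e = t)"
    unfolding weight_def lookup_push by (rule sum.swap)
  also have "\<dots> = (\<Sum>e\<in>E\<^sub>0. if \<pi> e \<in> C then Poly_Mapping.lookup m e else 0)"
    using assms by (simp add: when_def)
  also have "\<dots> = weight {e\<in>E\<^sub>0. \<pi> e \<in> C} m"
    using finite_sets by (simp add: weight_def sum.inter_filter)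
  finally show ?thesis .
qed

text \<open>A unit of exponent at \<open>e\<close> contributes one unit at \<open>\<pi> e\<close> to \<open>push m = u + v\<close>, so it can be charged to
\<open>u\<close> or to \<open>v\<close>, whichever is positive there. Induction on \<open>m\<close> removes one unit at a time.
The exponents of elements outside \<open>E\<^sub>0\<close> are invisible to \<open>push\<close> and are put into the first summand.\<close>

lemma push_eq_add_split:
  assumes "push m = u + v"
  shows "\<exists>u' v'. m = u' + v' \<and> push u' = u \<and> push v' = v"
  using assms
proof (induction m arbitrary: u v rule: exponent_induct)
  case zero
  then have "u + v = 0" by (simp add: push_zero)
  then have "u = 0" "v = 0" by (auto simp: poly_mapping_eq_iff fun_eq_iff lookup_add)
  then show ?case by (intro exI[of _ 0]) (simp add: push_zero)
next
  case (add m e)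
  show ?case
  proof (cases "e \<in> E\<^sub>0")
    case False
    then have "push m = u + v" using add.prems by (simp add: push_add push_single)
    then obtain u' v' where "m = u' + v'" "push u' = u" "push v' = v" using add.IH by blast
    then have "m + Poly_Mapping.single e 1 = (u' + Poly_Mapping.single e 1) + v'"
      "push (u' + Poly_Mapping.single e 1) = u" "push v' = v"
      using False by (simp_all add: push_add push_single ac_simps)
    then show ?thesis by blast
  next
    case True
    let ?e = "Poly_Mapping.single e (1::nat)" and ?t = "Poly_Mapping.single (\<pi> e) (1::nat)"
    have push_e: "push ?e = ?t" using True by (simp add: push_single)
    have eq: "push m + ?t = u + v" using add.prems True by (simp add: push_add push_single)
    have "\<pi> e \<in> Poly_Mapping.keys (u + v)"
      unfolding eq[symmetric] by (simp add: in_keys_iff lookup_add)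
    then consider "\<pi> e \<in> Poly_Mapping.keys u" | "\<pi> e \<in> Poly_Mapping.keys v"
      using Poly_Mapping.keys_add[of u v] by blast
    then show ?thesis
    proof cases
      case 1
      then obtain w where w: "u = w + ?t" by (rule split_off_single)
      have "push m + ?t = (w + v) + ?t" using eq by (simp add: w ac_simps)
      then have "push m = w + v" by (rule add_right_imp_eq)
      then obtain w' v' where "m = w' + v'" "push w' = w" "push v' = v" using add.IH by blast
      then have "m + ?e = (w' + ?e) + v'" "push (w' + ?e) = u" "push v' = v"
        by (simp_all add: push_add push_e[simplified] w ac_simps)
      then show ?thesis by blast
    next
      case 2
      then obtain w where w: "v = w + ?t" by (rule split_off_single)
      have "push m + ?t = (u + w) + ?t" using eq by (simp add: w ac_simps)
      then have "push m = u + w" by (rule add_right_imp_eq)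
      then obtain u' w' where "m = u' + w'" "push u' = u" "push w' = w" using add.IH by blast
      then have "m + ?e = u' + (w' + ?e)" "push u' = u" "push (w' + ?e) = v"
        by (simp_all add: push_add push_e[simplified] w ac_simps)
      then show ?thesis by blast
    qed
  qed
qed

text \<open>If the support of \<open>push m\<close> contains a member \<open>C\<close> of \<open>\<C>\<close>, choosing a preimage in the support of
\<open>m\<close> for each element of \<open>C\<close> gives a member of the blow-up.\<close>

lemma clutter_exponents_blowup:
  "clutter_exponents E (blowup \<C>) = {m\<in>exponents E. push m \<in> clutter_exponents T \<C>}"
proof -
  have "(\<exists>B\<in>blowup \<C>. B \<subseteq> K) \<longleftrightarrow> (\<exists>C\<in>\<C>. C \<subseteq> \<pi> ` (K \<inter> E\<^sub>0))" for K
  proof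
    assume "\<exists>B\<in>blowup \<C>. B \<subseteq> K"
    then obtain B where B: "B \<subseteq> E\<^sub>0" "\<pi> ` B \<in> \<C>" "B \<subseteq> K" by (auto simp: blowup_def)
    then have "\<pi> ` B \<subseteq> \<pi> ` (K \<inter> E\<^sub>0)" by blast
    with B(2) show "\<exists>C\<in>\<C>. C \<subseteq> \<pi> ` (K \<inter> E\<^sub>0)" ..
  next
    assume "\<exists>C\<in>\<C>. C \<subseteq> \<pi> ` (K \<inter> E\<^sub>0)"
    then obtain C where "C \<in> \<C>" "C \<subseteq> \<pi> ` (K \<inter> E\<^sub>0)" by blast
    then obtain B where "B \<subseteq> K \<inter> E\<^sub>0" "inj_on \<pi> B" "\<pi> ` B \<in> \<C>"
      by (auto simp: subset_image_inj)
    then show "\<exists>B\<in>blowup \<C>. B \<subseteq> K" by (auto simp: blowup_def)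
  qed
  then show ?thesis
    using push_mem by (auto simp: clutter_exponents_def keys_push)
qed

text \<open>The preimage of a cover is a cover, and its weight is that of the original cover after pushing
forward. Conversely, given a cover \<open>D\<close> of the blow-up, the elements of \<open>T\<close> whose whole fibre lies in
\<open>D\<close> form a cover: if \<open>C\<close> in \<open>\<C>\<close> had none of them, a preimage outside \<open>D\<close> could be chosen for each
element of \<open>C\<close>, and these would form a member of the blow-up that avoids \<open>D\<close>.\<close>

lemma symbolic_exponents_blowup:
  assumes sub: "\<C> \<subseteq> Pow T"
  shows "symbolic_exponents E (blowup \<C>) s = {m\<in>exponents E. push m \<in> symbolic_exponents T \<C> s}"
proof -
  have "(\<forall>D. cover E (blowup \<C>) D \<longrightarrow> s \<le> weight D m) \<longleftrightarrow>
      (\<forall>D. cover T \<C> D \<longrightarrow> s \<le> weight D (push m))" for m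
  proof (intro iffI allI impI)
    fix D assume *: "\<forall>D. cover E (blowup \<C>) D \<longrightarrow> s \<le> weight D m" and D: "cover T \<C> D"
    have "B \<inter> {e\<in>E\<^sub>0. \<pi> e \<in> D} \<noteq> {}" if "B \<in> blowup \<C>" for B
      using D that unfolding cover_def blowup_def by fastforce
    then have "cover E (blowup \<C>) {e\<in>E\<^sub>0. \<pi> e \<in> D}"
      using E\<^sub>0_subset by (auto simp: cover_def)
    moreover have "finite D" using D finite_sets by (auto simp: cover_def intro: finite_subset)
    ultimately show "s \<le> weight D (push m)" using * by (simp add: weight_push)
  next
    fix D assume *: "\<forall>D. cover T \<C> D \<longrightarrow> s \<le> weight D (push m)" and D: "cover E (blowup \<C>) D"
    let ?D = "{t\<in>T. {e\<in>E\<^sub>0. \<pi> e = t} \<subseteq> D}"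
    have "C \<inter> ?D \<noteq> {}" if C: "C \<in> \<C>" for C
    proof
      assume "C \<inter> ?D = {}"
      with sub C have "C \<subseteq> \<pi> ` (E\<^sub>0 - D)" by blast
      then obtain B where "B \<subseteq> E\<^sub>0 - D" "inj_on \<pi> B" "\<pi> ` B = C"
        by (auto simp: subset_image_inj)
      with C have "B \<in> blowup \<C>" "B \<inter> D = {}" by (auto simp: blowup_def)
      with D show False by (auto simp: cover_def)
    qed
    then have "cover T \<C> ?D" by (auto simp: cover_def)
    with * have "s \<le> weight ?D (push m)" by blast
    also have "\<dots> = weight {e\<in>E\<^sub>0. \<pi> e \<in> ?D} m" using finite_sets by (intro weight_push) simp
    also have "\<dots> \<le> weight D m"
      using D finite_E by (intro weight_mono) (auto simp: cover_def intro: finite_subset)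
    finally show "s \<le> weight D m" .
  qed
  then show ?thesis using push_mem by (auto simp: symbolic_exponents_def)
qed

lemma iterated_sum_blowup:
  "iterated_sum E {m\<in>exponents E. push m \<in> U} n = {m\<in>exponents E. push m \<in> iterated_sum T U n}"
proof (induction n)
  case 0
  then show ?case using push_mem by simp
next
  case (Suc n)
  have "(\<exists>u v. m = u + v \<and> (u \<in> exponents E \<and> push u \<in> iterated_sum T U n) \<and> v \<in> exponents E \<and> push v \<in> U)
      \<longleftrightarrow> m \<in> exponents E \<and> (\<exists>u v. push m = u + v \<and> u \<in> iterated_sum T U n \<and> v \<in> U)" for m
  proof
    assume "m \<in> exponents E \<and> (\<exists>u v. push m = u + v \<and> u \<in> iterated_sum T U n \<and> v \<in> U)"
    then obtain u v where m: "m \<in> exponents E" and uv: "push m = u + v" "u \<in> iterated_sum T U n" "v \<in> U"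
      by blast
    obtain u' v' where "m = u' + v'" "push u' = u" "push v' = v"
      using push_eq_add_split[OF uv(1)] by blast
    with m uv show "\<exists>u v. m = u + v \<and> (u \<in> exponents E \<and> push u \<in> iterated_sum T U n) \<and> v \<in> exponents E \<and> push v \<in> U"
      by (metis exponents_add_iff)
  next
    assume "\<exists>u v. m = u + v \<and> (u \<in> exponents E \<and> push u \<in> iterated_sum T U n) \<and> v \<in> exponents E \<and> push v \<in> U"
    then show "m \<in> exponents E \<and> (\<exists>u v. push m = u + v \<and> u \<in> iterated_sum T U n \<and> v \<in> U)"
      using exponents_add_iff push_add by blast
  qed
  then show ?case by (simp add: Suc)
qed

lemma Collect_push_subset_iff:
  assumes "U \<subseteq> exponents T"
  shows "{m\<in>exponents E. push m \<in> U} \<subseteq> {m\<in>exponents E. push m \<in> V} \<longleftrightarrow> U \<subseteq> V"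
  using assms exponents_T_subset push_id by fastforce

text \<open>A vector supported on \<open>T\<close> is its own push-forward, and pushing forward only discards the exponents
of elements outside \<open>E\<^sub>0\<close>; so least degrees are unchanged even though \<open>push\<close> may lower
a degree.\<close>

lemma alpha_push:
  assumes U: "U \<subseteq> exponents T"
  shows "alpha (monomial_span {m\<in>exponents E. push m \<in> U} :: ('a, 'k::field) mpoly set) =
    alpha (monomial_span U :: ('a, 'k) mpoly set)"
  unfolding alpha_monomial_span
proof (rule Least_eqI)
  fix d assume "\<exists>m\<in>U. (\<Sum>e\<in>Poly_Mapping.keys m. Poly_Mapping.lookup m e) = d"
  then obtain m where m: "m \<in> U" "(\<Sum>e\<in>Poly_Mapping.keys m. Poly_Mapping.lookup m e) = d" by blast
  then have "m \<in> {m\<in>exponents E. push m \<in> U}" using U exponents_T_subset push_id by fastforce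
  with m(2) show "\<exists>m\<in>{m\<in>exponents E. push m \<in> U}. (\<Sum>e\<in>Poly_Mapping.keys m. Poly_Mapping.lookup m e) = d"
    by blast
next
  fix d assume "\<exists>m\<in>{m\<in>exponents E. push m \<in> U}. (\<Sum>e\<in>Poly_Mapping.keys m. Poly_Mapping.lookup m e) = d"
  then obtain m where m: "m \<in> exponents E" "push m \<in> U"
    "(\<Sum>e\<in>Poly_Mapping.keys m. Poly_Mapping.lookup m e) = d" by blast
  have "(\<Sum>e\<in>Poly_Mapping.keys (push m). Poly_Mapping.lookup (push m) e) = weight T (push m)"
    by (rule degree_eq_weight[OF finite_sets(2) push_mem])
  also have "\<dots> \<le> weight E m"
    using finite_E E\<^sub>0_subset by (subst weight_push[OF finite_sets(2)], intro weight_mono) auto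
  also have "\<dots> = d" using m by (simp add: degree_eq_weight[OF finite_E])
  finally show "\<exists>d'\<le>d. \<exists>m\<in>U. (\<Sum>e\<in>Poly_Mapping.keys m. Poly_Mapping.lookup m e) = d'"
    using m(2) by blast
qed

lemma invariants_blowup:
  assumes sub: "\<C> \<subseteq> Pow T"
  shows "waldschmidt E (monomial_span (clutter_exponents E (blowup \<C>)) :: ('a, 'k::field) mpoly set) =
      waldschmidt T (monomial_span (clutter_exponents T \<C>) :: ('a, 'k) mpoly set)"
    and "asymp_resurgence E (monomial_span (clutter_exponents E (blowup \<C>)) :: ('a, 'k) mpoly set) =
      asymp_resurgence T (monomial_span (clutter_exponents T \<C>) :: ('a, 'k) mpoly set)"
proof -
  have subE: "blowup \<C> \<subseteq> Pow E" using E\<^sub>0_subset by (auto simp: blowup_def)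
  have sT: "symbolic_exponents T \<C> s \<subseteq> exponents T" for s by (auto simp: symbolic_exponents_def)
  note symb = symbolic_power_clutter[OF finite_E subE] symbolic_power_clutter[OF finite_sets(2) sub]
    symbolic_exponents_blowup[OF sub]
  show "waldschmidt E (monomial_span (clutter_exponents E (blowup \<C>)) :: ('a, 'k::field) mpoly set) =
      waldschmidt T (monomial_span (clutter_exponents T \<C>) :: ('a, 'k) mpoly set)"
    unfolding waldschmidt_def by (simp add: symb alpha_push[OF sT])
  have "symbolic_power (mpoly_ring E) (monomial_span (clutter_exponents E (blowup \<C>)) :: ('a, 'k) mpoly set) s
        \<subseteq> ideal_power (mpoly_ring E) (monomial_span (clutter_exponents E (blowup \<C>))) r \<longleftrightarrow>
      symbolic_power (mpoly_ring T) (monomial_span (clutter_exponents T \<C>) :: ('a, 'k) mpoly set) s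
        \<subseteq> ideal_power (mpoly_ring T) (monomial_span (clutter_exponents T \<C>)) r" for s r
    unfolding symb ideal_power_monomial_span monomial_span_subset_iff
    unfolding clutter_exponents_blowup iterated_sum_blowup Collect_push_subset_iff[OF sT] ..
  then show "asymp_resurgence E (monomial_span (clutter_exponents E (blowup \<C>)) :: ('a, 'k) mpoly set) =
      asymp_resurgence T (monomial_span (clutter_exponents T \<C>) :: ('a, 'k) mpoly set)"
    unfolding asymp_resurgence_def by simp
qed

end

section \<open>Bases, closure and contraction in a matroid\<close>

lemma matroidD:
  assumes "matroid M"
  shows "finite (ground M)" "indep M X \<Longrightarrow> X \<subseteq> ground M" "indep M {}"
    "indep M X \<Longrightarrow> Y \<subseteq> X \<Longrightarrow> indep M Y"
    "indep M X \<Longrightarrow> indep M Y \<Longrightarrow> card Y < card X \<Longrightarrow> \<exists>e\<in>X - Y. indep M (insert e Y)"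
  using assms unfolding matroid_def by blast+

lemma indep_finite: "matroid M \<Longrightarrow> indep M X \<Longrightarrow> finite X"
  by (meson finite_subset matroidD(1,2))

lemma matroid_restrict_to: "matroid M \<Longrightarrow> matroid (restrict_to M T)"
  unfolding matroid_def restrict_to_def by simp (meson Diff_iff order_trans subsetD)

lemma basis_restrict_to_iff:
  "basis (restrict_to M A) B \<longleftrightarrow>
    B \<subseteq> A \<and> indep M B \<and> (\<forall>C\<subseteq>A. indep M C \<longrightarrow> B \<subseteq> C \<longrightarrow> C = B)"
  by (auto simp: basis_def restrict_to_def)

lemma basis_restrict_to_insert:
  assumes "basis (restrict_to M A) B" "e \<in> A" "e \<notin> B"
  shows "\<not> indep M (insert e B)"
  using assms unfolding basis_restrict_to_iff by (metis insert_subset insertI1 subset_insertI)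

lemma augment_to_card:
  assumes M: "matroid M" and "indep M X" "indep M Y" "card Y \<le> card X"
  obtains W where "Y \<subseteq> W" "W \<subseteq> X \<union> Y" "indep M W" "card W = card X"
proof -
  have "\<exists>W. Y \<subseteq> W \<and> W \<subseteq> X \<union> Y \<and> indep M W \<and> card W = card X"
    using assms(3,4)
  proof (induction "card X - card Y" arbitrary: Y)
    case 0
    then show ?case by auto
  next
    case (Suc n)
    then have "card Y < card X" by linarith
    then obtain e where e: "e \<in> X - Y" "indep M (insert e Y)"
      using matroidD(5)[OF M assms(2) Suc.prems(1)] by blast
    have "card (insert e Y) = Suc (card Y)"
      using e indep_finite[OF M Suc.prems(1)] by simp
    then have "\<exists>W. insert e Y \<subseteq> W \<and> W \<subseteq> X \<union> insert e Y \<and> indep M W \<and> card W = card X"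
      using Suc.hyps(2) Suc.prems e by (intro Suc.hyps(1)) linarith+
    then show ?case using e by blast
  qed
  then show thesis using that by blast
qed

lemma card_le_card_basis:
  assumes M: "matroid M" and B: "basis (restrict_to M A) B" and "indep M X" "X \<subseteq> A"
  shows "card X \<le> card B"
proof (rule ccontr)
  assume "\<not> ?thesis"
  moreover have "indep M B" using B by (simp add: basis_restrict_to_iff)
  ultimately obtain e where "e \<in> X - B" "indep M (insert e B)"
    using matroidD(5)[OF M assms(3), of B] by force
  with basis_restrict_to_insert[OF B] assms(4) show False by blast
qed

lemma rank_of_eq_card_basis:
  assumes M: "matroid M" and B: "basis (restrict_to M A) B"
  shows "rank_of M A = card B"
  unfolding rank_of_def
proof (rule Max_eqI)
  show "finite {card X |X. X \<subseteq> A \<and> indep M X}"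
    by (rule finite_subset[of _ "card ` Pow (ground M)"]) (use matroidD[OF M] in auto)
qed (use card_le_card_basis[OF M B] B in \<open>auto simp: basis_restrict_to_iff\<close>)

lemma basis_restrict_to_exists:
  assumes M: "matroid M"
  obtains B where "basis (restrict_to M A) B"
proof -
  have "finite {X. X \<subseteq> A \<and> indep M X}"
    by (rule finite_subset[of _ "Pow (ground M)"]) (use matroidD[OF M] in auto)
  from finite_has_maximal[OF this] obtain B where
    "B \<in> {X. X \<subseteq> A \<and> indep M X}" "\<forall>C\<in>{X. X \<subseteq> A \<and> indep M X}. B \<subseteq> C \<longrightarrow> B = C"
    using matroidD(3)[OF M] by auto
  then have "basis (restrict_to M A) B" by (auto simp: basis_restrict_to_iff)
  then show thesis by (rule that)
qed

text \<open>The operator \<open>cl\<close> is defined as a greatest set, whose existence has to be shown. A basis \<open>B\<close> of \<open>A\<close>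
remains maximal independent in the set of all elements of \<open>B\<close> and all \<open>e\<close> that make \<open>B\<close> dependent;
and a set of the same rank as \<open>A\<close> that contains \<open>A\<close> cannot have any other element.\<close>

lemma cl_eq:
  assumes M: "matroid M" and A: "A \<subseteq> ground M" and B: "basis (restrict_to M A) B"
  shows "cl M A = {e\<in>ground M. e \<in> B \<or> \<not> indep M (insert e B)}"
    and "basis (restrict_to M (cl M A)) B"
proof -
  let ?K = "{e\<in>ground M. e \<in> B \<or> \<not> indep M (insert e B)}"
  have AK: "A \<subseteq> ?K" using basis_restrict_to_insert[OF B] A by auto
  \<comment> \<open>The rank of the candidate is that of \<open>A\<close>, as \<open>B\<close> is still maximal in it.\<close>
  have BK: "basis (restrict_to M ?K) B"
    unfolding basis_restrict_to_iff
  proof (intro conjI allI impI)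
    show "B \<subseteq> ?K" "indep M B" using B AK by (auto simp: basis_restrict_to_iff)
    fix C assume C: "C \<subseteq> ?K" "indep M C" "B \<subseteq> C"
    have "e \<in> B" if "e \<in> C" for e
    proof -
      have "indep M (insert e B)" using matroidD(4)[OF M C(2)] that C(3) by blast
      then show ?thesis using that C(1) by blast
    qed
    with C show "C = B" by blast
  qed
  have "cl M A = ?K"
    unfolding cl_def
  proof (rule Greatest_equality)
    show "A \<subseteq> ?K \<and> ?K \<subseteq> ground M \<and> rank_of M ?K = rank_of M A"
      using AK rank_of_eq_card_basis[OF M B] rank_of_eq_card_basis[OF M BK] by auto
    fix X assume X: "A \<subseteq> X \<and> X \<subseteq> ground M \<and> rank_of M X = rank_of M A"
    obtain D where D: "basis (restrict_to M X) D" by (rule basis_restrict_to_exists[OF M])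
    then have card: "card D = card B"
      using X rank_of_eq_card_basis[OF M D] rank_of_eq_card_basis[OF M B] by simp
    have "\<not> indep M (insert e B)" if e: "e \<in> X" "e \<notin> B" for e
    proof
      assume ind: "indep M (insert e B)"
      have "insert e B \<subseteq> X" using e X B by (auto simp: basis_restrict_to_iff)
      from card_le_card_basis[OF M D ind this] show False
        using card e indep_finite[OF M ind] by simp
    qed
    then show "X \<subseteq> ?K" using X by auto
  qed
  then show "cl M A = ?K" "basis (restrict_to M (cl M A)) B" using BK by simp_all
qed

text \<open>Any basis of \<open>U\<close> may be used to test independence in the contraction: if \<open>X \<union> C\<close> is
independent, \<open>B\<close> can be augmented from it to a set of the same size, and the elements added to \<open>B\<close> all
come from \<open>X\<close>, because \<open>B\<close> is already maximal in \<open>U\<close>.\<close>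

lemma contract_indep_iff:
  assumes M: "matroid M" and B: "basis (restrict_to M U) B"
  shows "indep (contract M U) X \<longleftrightarrow> X \<subseteq> ground M - U \<and> indep M (X \<union> B)"
proof -
  have "indep M (X \<union> B)" if X: "X \<subseteq> ground M - U" and C: "basis (restrict_to M U) C" "indep M (X \<union> C)" for C
  proof -
    have ind: "indep M B" and BU: "B \<subseteq> U" "C \<subseteq> U" using B C by (auto simp: basis_restrict_to_iff)
    have card: "card B = card C"
      using rank_of_eq_card_basis[OF M B] rank_of_eq_card_basis[OF M C(1)] by simp
    have fin: "finite X" "finite C" "finite B"
      using indep_finite[OF M C(2)] indep_finite[OF M ind] by auto
    have cXC: "card (X \<union> C) = card X + card C" "card (X \<union> B) = card X + card B"
      using X BU fin by (auto intro!: card_Un_disjoint)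
    then obtain W where W: "B \<subseteq> W" "W \<subseteq> X \<union> C \<union> B" "indep M W" "card W = card (X \<union> C)"
      using augment_to_card[OF M C(2) ind] card by auto
    have "W \<inter> U = B"
      using B matroidD(4)[OF M W(3), of "W \<inter> U"] W(1) BU by (auto simp: basis_restrict_to_iff)
    then have "W \<subseteq> X \<union> B" using W(2) BU by blast
    then have "W = X \<union> B" using W(4) cXC card fin by (intro card_subset_eq) auto
    then show ?thesis using W(3) by simp
  qed
  then show ?thesis using B by (auto simp: contract_def)
qed

section \<open>Parallel elements and the simplification\<close>

text \<open>Extend \<open>{f}\<close> from \<open>insert e Z\<close> to a set of the same size. It cannot contain \<open>e\<close>, so it has to be
\<open>insert f Z\<close>.\<close>

lemma indep_exchange_parallel:
  assumes M: "matroid M" and "indep M (insert e Z)" "e \<notin> Z" "indep M {f}" "\<not> indep M {e, f}"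
  shows "indep M (insert f Z)" "f \<notin> Z"
proof -
  show fZ: "f \<notin> Z"
    using assms(5) matroidD(4)[OF M assms(2), of "{e, f}"] by blast
  have fin: "finite Z" using indep_finite[OF M assms(2)] by simp
  then obtain W where W: "{f} \<subseteq> W" "W \<subseteq> insert e Z \<union> {f}" "indep M W" "card W = card (insert e Z)"
    using augment_to_card[OF M assms(2,4)] assms(3) by auto
  have "e \<notin> W"
    using assms(5) matroidD(4)[OF M W(3), of "{e, f}"] W(1) by blast
  then have "W = insert f Z"
    using W fin fZ assms(3) by (intro card_subset_eq) auto
  then show "indep M (insert f Z)" using W(3) by simp
qed

text \<open>The elements \<open>f i\<close> are exchanged for \<open>g i\<close> one at a time. Indexing both families over \<open>I\<close> lets
the same lemma pass from a set to its representatives and back. The set \<open>Y\<close> collects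
what has already been exchanged during the induction, and afterwards serves for contractions.\<close>

lemma indep_replace_parallel:
  assumes M: "matroid M" and "finite I"
    and "inj_on f I" "f ` I \<inter> Y = {}" "indep M (f ` I \<union> Y)"
    and "\<And>i. i \<in> I \<Longrightarrow> indep M {g i} \<and> (f i = g i \<or> \<not> indep M {f i, g i})"
  shows "inj_on g I \<and> g ` I \<inter> Y = {} \<and> indep M (g ` I \<union> Y)"
  using assms(2-)
proof (induction I arbitrary: Y rule: finite_induct)
  case empty
  then show ?case by simp
next
  case (insert i I)
  let ?Z = "f ` I \<union> Y"
  have Z: "indep M (insert (f i) ?Z)" "f i \<notin> ?Z"
    using insert.prems insert.hyps by (auto simp: inj_on_def)
  have "indep M (insert (g i) ?Z) \<and> g i \<notin> ?Z"
    using indep_exchange_parallel[OF M Z, of "g i"] Z insert.prems(4)[of i] by auto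
  then have "inj_on g I \<and> g ` I \<inter> insert (g i) Y = {} \<and> indep M (g ` I \<union> insert (g i) Y)"
    using insert.prems by (intro insert.IH) auto
  then show ?case using insert.hyps \<open>indep M (insert (g i) ?Z) \<and> g i \<notin> ?Z\<close> by auto
qed

text \<open>The map \<open>\<pi>\<close> chooses a representative in \<open>T\<close> of each parallel class of non-loops.\<close>

definition parallel_retraction :: "'a matroid \<Rightarrow> 'a set \<Rightarrow> ('a \<Rightarrow> 'a) \<Rightarrow> bool" where
  "parallel_retraction M T \<pi> \<longleftrightarrow> T \<subseteq> ground M \<and> (\<forall>t\<in>T. indep M {t} \<and> \<pi> t = t) \<and>
    (\<forall>e. indep M {e} \<longrightarrow> \<pi> e \<in> T \<and> (e = \<pi> e \<or> \<not> indep M {e, \<pi> e}))"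

lemma parallel_retractionD:
  assumes "parallel_retraction M T \<pi>"
  shows "T \<subseteq> ground M" "t \<in> T \<Longrightarrow> indep M {t}" "t \<in> T \<Longrightarrow> \<pi> t = t"
    "indep M {e} \<Longrightarrow> \<pi> e \<in> T" "indep M {e} \<Longrightarrow> e = \<pi> e \<or> \<not> indep M {e, \<pi> e}"
  using assms unfolding parallel_retraction_def by simp_all

text \<open>The closure of a non-loop is a flat of rank one, and it consists of the loops and the elements parallel
to it. The representative chosen in this flat by the simplification is the value of \<open>\<pi>\<close>.\<close>

lemma simplification_retraction:
  assumes M: "matroid M" and N: "is_simplification M N"
  obtains T \<pi> where "N = restrict_to M T" "parallel_retraction M T \<pi>"
proof -
  obtain T where "T \<subseteq> ground M" and *: "(\<forall>e\<in>T. \<not> loop M e) \<and>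
      (\<forall>G. flat M G \<and> rank_of M G = 1 \<longrightarrow> (\<exists>!e. e \<in> T \<inter> G)) \<and> N = restrict_to M T"
    using N unfolding is_simplification_def by (elim exE conjE) (rule that, assumption, intro conjI)
  then have T: "T \<subseteq> ground M" "\<And>e. e \<in> T \<Longrightarrow> \<not> loop M e" "N = restrict_to M T"
    by simp_all
  have ex1: "\<exists>!e. e \<in> T \<inter> G" if "flat M G" "rank_of M G = 1" for G
    using * that by simp
  have ind: "indep M {t}" if "t \<in> T" for t
    using T(1) T(2)[OF that] that by (auto simp: loop_def)
  have cl1: "cl M {e} = {f\<in>ground M. f = e \<or> \<not> indep M {e, f}}"
    and uniq: "\<exists>!t. t \<in> T \<inter> cl M {e}" if e: "indep M {e}" for e
  proof -
    have sub: "{e} \<subseteq> ground M" using matroidD(2)[OF M e] .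
    have basis: "basis (restrict_to M {e}) {e}" using e by (auto simp: basis_restrict_to_iff)
    note cl = cl_eq[OF M sub basis]
    show "cl M {e} = {f\<in>ground M. f = e \<or> \<not> indep M {e, f}}"
      using cl(1) by (auto simp: insert_commute)
    have "cl M {e} \<subseteq> ground M" using cl(1) by auto
    then have "flat M (cl M {e})"
      using cl_eq(1)[OF M _ cl(2)] cl(1) by (simp add: flat_def)
    moreover have "rank_of M (cl M {e}) = 1" using rank_of_eq_card_basis[OF M cl(2)] by simp
    ultimately show "\<exists>!t. t \<in> T \<inter> cl M {e}" by (rule ex1)
  qed
  define \<pi> where "\<pi> e = (THE t. t \<in> T \<inter> cl M {e})" for e
  have pi: "\<pi> e \<in> T \<inter> cl M {e}" if "indep M {e}" for e
    unfolding \<pi>_def by (rule theI'[OF uniq[OF that]])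
  have "\<pi> t = t" if t: "t \<in> T" for t
  proof -
    have "t \<in> T \<inter> cl M {t}" using t T(1) cl1[OF ind[OF t]] by auto
    then show ?thesis using uniq[OF ind[OF t]] pi[OF ind[OF t]] by blast
  qed
  moreover have "\<pi> e \<in> T \<and> (e = \<pi> e \<or> \<not> indep M {e, \<pi> e})" if "indep M {e}" for e
    using pi[OF that] cl1[OF that] by auto
  ultimately have "parallel_retraction M T \<pi>"
    using T(1) ind by (simp add: parallel_retraction_def)
  with T(3) show thesis by (rule that)
qed

text \<open>With \<open>Y = {}\<close> this compares a matroid with its simplification. With \<open>Y\<close> a basis of a flat it
compares the corresponding contractions.\<close>

lemma indep_retraction_iff:
  assumes M: "matroid M" and ret: "parallel_retraction M T \<pi>"
  shows "indep M (X \<union> Y) \<and> X \<inter> Y = {} \<longleftrightarrow>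
    (\<forall>e\<in>X. indep M {e}) \<and> inj_on \<pi> X \<and> indep M (\<pi> ` X \<union> Y) \<and> \<pi> ` X \<inter> Y = {}"
proof
  note pi = parallel_retractionD(4,5)[OF ret]
  have nonloop: "indep M {\<pi> e}" if "indep M {e}" for e
    using parallel_retractionD(2,4)[OF ret] that by blast
  assume X: "indep M (X \<union> Y) \<and> X \<inter> Y = {}"
  have nl: "\<forall>e\<in>X. indep M {e}"
    using matroidD(4)[OF M conjunct1[OF X]] by blast
  have "finite X" using indep_finite[OF M] X by blast
  then have "inj_on \<pi> X \<and> \<pi> ` X \<inter> Y = {} \<and> indep M (\<pi> ` X \<union> Y)"
    using indep_replace_parallel[OF M, of X "\<lambda>e. e" Y \<pi>] X nl pi(2) nonloop by simp
  with nl show "(\<forall>e\<in>X. indep M {e}) \<and> inj_on \<pi> X \<and> indep M (\<pi> ` X \<union> Y) \<and> \<pi> ` X \<inter> Y = {}"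
    by blast
next
  assume X: "(\<forall>e\<in>X. indep M {e}) \<and> inj_on \<pi> X \<and> indep M (\<pi> ` X \<union> Y) \<and> \<pi> ` X \<inter> Y = {}"
  have "finite (\<pi> ` X)" using indep_finite[OF M] X by blast
  then have "finite X" using X finite_imageD by blast
  then show "indep M (X \<union> Y) \<and> X \<inter> Y = {}"
    using indep_replace_parallel[OF M, of X \<pi> Y "\<lambda>e. e"] X parallel_retractionD(5)[OF ret] by (fastforce simp: insert_commute)
qed

section \<open>Facet ideals of a matroid and of its simplification\<close>

lemma facet_ideal_eq_clutter:
  assumes "finite (ground M)" "\<And>X. indep M X \<Longrightarrow> X \<subseteq> ground M"
  shows "(facet_ideal M :: ('a, 'k::field) mpoly set) =
    monomial_span (clutter_exponents (ground M) {B. basis M B})"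
  using Idl_squarefree[of "ground M" "{B. basis M B}"] assms
  by (auto simp: facet_ideal_def basis_def)

context retraction
begin

text \<open>Maximality transfers because an independent set of \<open>N\<close> containing \<open>\<pi> ` B\<close> lifts to
an independent set of \<open>M\<close> containing \<open>B\<close>: keep \<open>B\<close> and add the new elements, which are their own
images.\<close>

lemma bases_eq_blowup:
  assumes ind: "\<And>X. indep M X \<longleftrightarrow> X \<subseteq> E\<^sub>0 \<and> inj_on \<pi> X \<and> indep N (\<pi> ` X)"
    and sub: "\<And>Y. indep N Y \<Longrightarrow> Y \<subseteq> T"
  shows "{B. basis M B} = blowup {C. basis N C}"
proof (intro equalityI subsetI)
  fix B assume "B \<in> {B. basis M B}"
  then have B: "B \<subseteq> E\<^sub>0" "inj_on \<pi> B" "indep N (\<pi> ` B)"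
    and max: "\<And>X. indep M X \<Longrightarrow> B \<subseteq> X \<Longrightarrow> X = B"
    by (auto simp: basis_def ind)
  have "C = \<pi> ` B" if C: "indep N C" "\<pi> ` B \<subseteq> C" for C
  proof -
    let ?X = "B \<union> (C - \<pi> ` B)"
    have id: "\<pi> c = c" if "c \<in> C" for c using that sub[OF C(1)] pi_id by blast
    then have im: "\<pi> ` (C - \<pi> ` B) = C - \<pi> ` B" by (intro equalityI subsetI) (auto simp: image_iff)
    have "inj_on \<pi> (C - \<pi> ` B)" using id by (intro inj_onI) simp
    then have "inj_on \<pi> ?X" unfolding inj_on_Un using B(2) im by blast
    moreover have "\<pi> ` ?X = C" unfolding image_Un im using C(2) by blast
    ultimately have "indep M ?X" using B(1) C(1) sub[OF C(1)] T_subset by (auto simp: ind)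
    then have "?X = B" by (rule max) blast
    with \<open>\<pi> ` ?X = C\<close> show ?thesis by simp
  qed
  with B show "B \<in> blowup {C. basis N C}" by (auto simp: blowup_def basis_def)
next
  fix B assume "B \<in> blowup {C. basis N C}"
  then have B: "B \<subseteq> E\<^sub>0" "inj_on \<pi> B" "indep N (\<pi> ` B)"
    and max: "\<And>C. indep N C \<Longrightarrow> \<pi> ` B \<subseteq> C \<Longrightarrow> C = \<pi> ` B"
    by (auto simp: blowup_def basis_def)
  have "X = B" if X: "indep M X" "B \<subseteq> X" for X
  proof -
    have X': "inj_on \<pi> X" "indep N (\<pi> ` X)" using X(1) by (simp_all add: ind)
    with X(2) have "\<pi> ` X = \<pi> ` B" by (intro max) auto
    with X' X(2) show ?thesis by (auto simp: inj_on_image_eq_iff)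
  qed
  with B show "B \<in> {B. basis M B}" by (auto simp: basis_def ind)
qed

lemma facet_ideal_invariants:
  assumes "ground M = E" "ground N = T"
    and ind: "\<And>X. indep M X \<longleftrightarrow> X \<subseteq> E\<^sub>0 \<and> inj_on \<pi> X \<and> indep N (\<pi> ` X)"
    and sub: "\<And>Y. indep N Y \<Longrightarrow> Y \<subseteq> T"
  shows "waldschmidt E (facet_ideal M :: ('a, 'k::field) mpoly set) =
      waldschmidt T (facet_ideal N :: ('a, 'k) mpoly set)"
    and "asymp_resurgence E (facet_ideal M :: ('a, 'k) mpoly set) =
      asymp_resurgence T (facet_ideal N :: ('a, 'k) mpoly set)"
proof -
  have "indep M X \<Longrightarrow> X \<subseteq> E" for X using ind E\<^sub>0_subset by blast
  then have M: "(facet_ideal M :: ('a, 'k) mpoly set) =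
      monomial_span (clutter_exponents E (blowup {C. basis N C}))"
    using facet_ideal_eq_clutter[of M, where ?'k = 'k] assms(1) finite_E bases_eq_blowup[OF ind sub] by simp
  have N: "(facet_ideal N :: ('a, 'k) mpoly set) =
      monomial_span (clutter_exponents T {C. basis N C})"
    using facet_ideal_eq_clutter[of N, where ?'k = 'k] assms(2) sub finite_sets by simp
  have T: "{C. basis N C} \<subseteq> Pow T" using sub by (auto simp: basis_def)
  show "waldschmidt E (facet_ideal M :: ('a, 'k::field) mpoly set) =
      waldschmidt T (facet_ideal N :: ('a, 'k) mpoly set)"
    unfolding M N by (rule invariants_blowup(1)[OF T])
  show "asymp_resurgence E (facet_ideal M :: ('a, 'k) mpoly set) =
      asymp_resurgence T (facet_ideal N :: ('a, 'k) mpoly set)"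
    unfolding M N by (rule invariants_blowup(2)[OF T])
qed

end

text \<open>A basis \<open>B\<close> of \<open>F\<close> in the simplification is also a basis of \<open>cl M F\<close> in \<open>M\<close>, so both contractions
are tested with the same \<open>B\<close>. All loops of \<open>M\<close> lie in \<open>cl M F\<close>, and a parallel class that meets
\<open>cl M F\<close> is contained in it; hence \<open>\<pi>\<close> restricts to a retraction between the ground sets of the contractions.\<close>

lemma waldschmidt_contract_simplification:
  fixes M N :: "'a matroid"
  assumes M: "matroid M" and N: "is_simplification M N" and F: "flat N F"
  shows "waldschmidt (ground (contract M (cl M F))) (facet_ideal (contract M (cl M F)) :: ('a, 'k::field) mpoly set) =
    waldschmidt (ground (contract N F)) (facet_ideal (contract N F) :: ('a, 'k) mpoly set)"
proof -
  obtain T \<pi> where N_eq: "N = restrict_to M T" and ret: "parallel_retraction M T \<pi>"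
    by (rule simplification_retraction[OF M N])
  note T = parallel_retractionD[OF ret]
  have gN: "ground N = T" and iN: "indep N X \<longleftrightarrow> X \<subseteq> T \<and> indep M X" for X
    using T(1) by (auto simp: N_eq restrict_to_def)
  have mN: "matroid N" unfolding N_eq by (rule matroid_restrict_to[OF M])
  have FT: "F \<subseteq> T" and clN: "cl N F = F" using F by (auto simp: flat_def gN)
  obtain B where BN: "basis (restrict_to N F) B" by (rule basis_restrict_to_exists[OF mN])
  then have BM: "basis (restrict_to M F) B" and BF: "B \<subseteq> F"
    using FT by (auto simp: basis_restrict_to_iff iN)
  have FM: "F \<subseteq> ground M" using FT T(1) by blast
  note clM = cl_eq[OF M FM BM]
  \<comment> \<open>The closure in \<open>M\<close> adds no further representatives to \<open>F\<close>, since \<open>F\<close> is a flat of \<open>N\<close>.\<close>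
  have F_eq: "t \<in> F \<longleftrightarrow> t \<in> cl M F" if "t \<in> T" for t
    using cl_eq(1)[OF mN _ BN] clN FT clM(1) that BF T(1) by (auto simp: gN iN)
  have nonloop: "indep M {e}" if "e \<in> ground M - cl M F" for e
    using that clM(1) matroidD(4)[OF M, of "insert e B" "{e}"] by auto
  \<comment> \<open>If the representative of \<open>e\<close> were in \<open>F\<close>, exchanging \<open>e\<close> for it would enlarge the basis \<open>B\<close> inside \<open>F\<close>.\<close>
  have rep: "\<pi> e \<in> T - F" if e: "e \<in> ground M - cl M F" for e
  proof -
    have pi: "\<pi> e \<in> T" "e = \<pi> e \<or> \<not> indep M {e, \<pi> e}" using T(4,5) nonloop[OF e] by blast+
    have "indep M (insert e B)" "e \<notin> B" using e clM(1) by auto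
    then have "indep M (insert (\<pi> e) B) \<and> \<pi> e \<notin> B"
      using indep_exchange_parallel[of M e B "\<pi> e"] M pi T(2) by (cases "e = \<pi> e") auto
    then have "\<pi> e \<notin> F" using basis_restrict_to_insert[OF BM] by blast
    with pi show ?thesis by blast
  qed
  interpret retraction "ground M - cl M F" "ground M - cl M F" "T - F" \<pi>
    by standard (use matroidD(1)[OF M] T(1,3) F_eq rep in auto)
  have indep_eq: "indep (contract M (cl M F)) X \<longleftrightarrow>
      X \<subseteq> ground M - cl M F \<and> inj_on \<pi> X \<and> indep (contract N F) (\<pi> ` X)" for X
  proof (cases "X \<subseteq> ground M - cl M F")
    case True
    have "B \<subseteq> cl M F" using clM(2) by (simp add: basis_restrict_to_iff)
    then have dis: "X \<inter> B = {}" "\<pi> ` X \<inter> B = {}" using True rep BF by blast+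
    have piX: "\<pi> ` X \<subseteq> T - F" "\<pi> ` X \<union> B \<subseteq> T" using True rep BF FT by blast+
    have "indep M (X \<union> B) \<longleftrightarrow> inj_on \<pi> X \<and> indep M (\<pi> ` X \<union> B)"
      using indep_retraction_iff[OF M ret, of X B] True nonloop dis by blast
    then show ?thesis
      using True piX by (simp add: contract_indep_iff[OF M clM(2)] contract_indep_iff[OF mN BN] gN iN)
  qed (simp add: contract_indep_iff[OF M clM(2)])
  have "indep (contract N F) Y \<Longrightarrow> Y \<subseteq> T - F" for Y
    by (simp add: contract_indep_iff[OF mN BN] gN)
  from facet_ideal_invariants(1)[OF _ _ indep_eq this] show ?thesis
    by (simp add: contract_def gN)
qed

lemma asymp_resurgence_simplification:
  fixes M N :: "'a matroid"
  assumes M: "matroid M" and N: "is_simplification M N"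
  shows "asymp_resurgence (ground M) (facet_ideal M :: ('a, 'k::field) mpoly set) =
    asymp_resurgence (ground N) (facet_ideal N :: ('a, 'k) mpoly set)"
proof -
  obtain T \<pi> where N_eq: "N = restrict_to M T" and ret: "parallel_retraction M T \<pi>"
    by (rule simplification_retraction[OF M N])
  note T = parallel_retractionD[OF ret]
  have gN: "ground N = T" and iN: "indep N X \<longleftrightarrow> X \<subseteq> T \<and> indep M X" for X
    using T(1) by (auto simp: N_eq restrict_to_def)
  interpret retraction "ground M" "{e. indep M {e}}" T \<pi>
    by standard (use matroidD(1)[OF M] matroidD(2)[OF M] T in auto)
  have "indep M X \<longleftrightarrow> X \<subseteq> {e. indep M {e}} \<and> inj_on \<pi> X \<and> indep N (\<pi> ` X)" for X
    using indep_retraction_iff[OF M ret, of X "{}"] T(4) by (auto simp: iN)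
  from facet_ideal_invariants(2)[OF _ _ this] show ?thesis
    by (simp add: gN iN)
qed

theorem theorem3p2:
  fixes M siM :: "'a matroid" and k :: nat
  assumes "matroid M"
    and "rk M = k"
    and "k < card (ground M)"
    and "is_simplification M siM"
  shows "(\<forall>i<k. \<forall>F. flat siM F \<and> rank_of siM F = i \<longrightarrow>
            waldschmidt (ground (contract M (cl M F)))
              (facet_ideal (contract M (cl M F)) :: ('a, 'k::field) mpoly set)
          = waldschmidt (ground (contract siM F))
              (facet_ideal (contract siM F) :: ('a, 'k) mpoly set)) \<and>
         asymp_resurgence (ground M) (facet_ideal M :: ('a, 'k) mpoly set)
       = asymp_resurgence (ground siM) (facet_ideal siM :: ('a, 'k) mpoly set)"
  using waldschmidt_contract_simplification[OF assms(1,4)]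
    asymp_resurgence_simplification[OF assms(1,4)] by blast

end
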